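(* For every $s\in(0,1)$ there exist positive numbers $\varphi_{0},c,g$ such that for all $\varphi$ with $|\varphi|\le\varphi_{0}$, all $\mu,\nu\in\mathbb Z^{2}$ and all $z\in\mathbb C\setminus\mathbb T$, \[\mathbb E\big(|\langle e_{\mu},R_\omega(\varphi,z)e_{\nu}\rangle|^{s}\big)\le c\,e^{-g|\mu-\nu|}.\]
   Context: Let $\{e_{\mu}\}_{\mu\in\mathbb Z^{2}}$ be the standard basis of $\ell^{2}(\mathbb Z^{2})$, $|\mu|$ the Euclidean norm, and $\mathbb T=\{z\in\mathbb C:|z|=1\}$. Let $\Omega=\mathbb T^{\mathbb Z^{2}}$ with the product $\sigma$-algebra and probability $\mathbb P=\bigotimes_{\mu\in\mathbb Z^{2}}d\ell$, $d\ell$ normalized Lebesgue measure on $\mathbb T$; $\mathbb E$ is expectation. $D_{\omega}e_{\mu}=\omega_{\mu}e_{\mu}$. $S_{\circlearrowleft}$ is the unitary permuting cyclically $e_{(2j,2k)}\mapsto e_{(2j+1,2k)}\mapsto e_{(2j+1,2k+1)}\mapsto e_{(2j,2k+1)}\mapsto e_{(2j,2k)}$ for all $j,k\in\mathbb Z$; $S_{\circlearrowright}$ is the unitary permuting cyclically $e_{(2j,2k)}\mapsto e_{(2j,2k-1)}\mapsto e_{(2j-1,2k-1)}\mapsto e_{(2j-1,2k)}\mapsto e_{(2j,2k)}$ for all $j,k$. $S(\varphi)=\cos\varphi\,S_{\circlearrowleft}+i\sin\varphi\,S_{\circlearrowright}$, $U_\omega(\varphi)=D_\omega S(\varphi)$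 on $\ell^2(\mathbb Z^2)$, and $R_\omega(\varphi,z)=(U_\omega(\varphi)-z)^{-1}$ for $z\in\mathbb C\setminus\mathbb T$. *)

theory Defs
  imports "HOL-Probability.Probability"
begin

type_synonym site = "int \<times> int"

definition ccw_map :: "site \<Rightarrow> site" where
  "ccw_map x = (case x of (a, b) \<Rightarrow>
     if even a \<and> even b then (a + 1, b)
     else if odd a \<and> even b then (a, b + 1)
     else if odd a \<and> odd b then (a - 1, b)
     else (a, b - 1))"

definition cw_map :: "site \<Rightarrow> site" where
  "cw_map x = (case x of (a, b) \<Rightarrow>
     if even a \<and> even b then (a, b - 1)
     else if even a \<and> odd b then (a - 1, b)
     else if odd a \<and> odd b then (a, b + 1)
     else (a + 1, b))"

text \<open>The unitary S e_x = e_(f x) acts on vectors psi by (S psi)(y) = psi (f^-1 y).\<close>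
definition perm_op :: "(site \<Rightarrow> site) \<Rightarrow> (site \<Rightarrow> complex) \<Rightarrow> site \<Rightarrow> complex" where
  "perm_op f \<psi> y = \<psi> (inv f y)"

definition S_op :: "real \<Rightarrow> (site \<Rightarrow> complex) \<Rightarrow> site \<Rightarrow> complex" where
  "S_op \<phi> \<psi> y = complex_of_real (cos \<phi>) * perm_op ccw_map \<psi> y
                 + \<i> * complex_of_real (sin \<phi>) * perm_op cw_map \<psi> y"

definition U_op :: "(site \<Rightarrow> complex) \<Rightarrow> real \<Rightarrow> (site \<Rightarrow> complex) \<Rightarrow> site \<Rightarrow> complex" where
  "U_op \<omega> \<phi> \<psi> y = \<omega> y * S_op \<phi> \<psi> y"

definition in_l2 :: "(site \<Rightarrow> complex) \<Rightarrow> bool" where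
  "in_l2 \<psi> \<longleftrightarrow> (\<lambda>x. (norm (\<psi> x))\<^sup>2) summable_on UNIV"

definition resolvent_entry ::
  "(site \<Rightarrow> complex) \<Rightarrow> real \<Rightarrow> complex \<Rightarrow> site \<Rightarrow> site \<Rightarrow> complex" where
  "resolvent_entry \<omega> \<phi> z \<mu> \<nu> =
     (THE \<psi>. in_l2 \<psi> \<and> (\<forall>y. U_op \<omega> \<phi> \<psi> y - z * \<psi> y = (if y = \<nu> then 1 else 0))) \<mu>"

definition circle_measure :: "complex measure" where
  "circle_measure = distr (uniform_measure lborel {0..2*pi}) borel cis"

definition Pomega :: "(site \<Rightarrow> complex) measure" where
  "Pomega = PiM UNIV (\<lambda>_. circle_measure)"

definition site_dist :: "site \<Rightarrow> site \<Rightarrow> real" where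
  "site_dist \<mu> \<nu> = sqrt ((real_of_int (fst \<mu> - fst \<nu>))\<^sup>2 + (real_of_int (snd \<mu> - snd \<nu>))\<^sup>2)"

end

theory Submission
  imports Defs
begin

text \<open>The operator stays unitary when the angle \<open>\<phi>\<close> varies from one pair of sites mixed by
  \<open>S(\<phi>)\<close> to the next. Setting the angle to zero around the plaquette of \<open>\<nu>\<close> cuts
  that plaquette off, and the resolvent identity bounds the entry at \<open>(\<mu>, \<nu>)\<close> by a sum of at most four
  terms, each \<open>O(\<phi>)\<close> times a decoupled entry at \<open>(\<mu>, t)\<close>, with \<open>t\<close> next to the
  plaquette, times a full entry inside the plaquette. The decoupled factor does not depend on the phases in the plaquette,
  so those can be averaged first, and the full entry then contributes a bounded factor: as a function of two phases
  it is a quotient with a bi-affine denominator, and unitarity bounds its numerator by one of the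
  extreme coefficients of the denominator, while \<open>|a + b w| powr (-s)\<close> is integrable over the circle
  for \<open>s < 1\<close>. Iterating over all angle fields bounded by \<open>\<phi>0\<close> gives exponential decay.\<close>

section \<open>Site-dependent angles and unitarity\<close>

text \<open>The decoupled operator is no longer of the form \<open>U_op \<omega> \<phi>\<close>, yet
  the next round of the iteration starts from it; the induction therefore runs over all angle fields
  that agree on each pair. The obstacle is that the full entry depends on every phase, so the two
  factors of a term are not independent. Only the phases of the plaquette of \<nu> can be integrated
  with the decoupled factor frozen, so the full entry must be evaluated inside that plaquette. The
  resolvent identity also produces values just outside it, and these are eliminated with the
  equation at the partner site. Uniformity in z up to the unit circle comes from the mass flux
  through a finite set: its direction depends only on whether |z| exceeds 1, never on the distance
  of z to the circle. It also decides which extreme coefficient is kept: the constant one for |z| >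
  1, the leading one for |z| < 1.\<close>

declare split_paired_All [simp del] split_paired_Ex [simp del]

definition ccw_inv :: "site \<Rightarrow> site" where
  "ccw_inv = (\<lambda>(a, b).
     if even a \<and> even b then (a, b + 1)
     else if odd a \<and> even b then (a - 1, b)
     else if odd a \<and> odd b then (a, b - 1)
     else (a + 1, b))"

definition cw_inv :: "site \<Rightarrow> site" where
  "cw_inv = (\<lambda>(a, b).
     if even a \<and> even b then (a - 1, b)
     else if even a \<and> odd b then (a, b + 1)
     else if odd a \<and> odd b then (a + 1, b)
     else (a, b - 1))"

lemma ccw_inv_ccw [simp]: "ccw_inv (ccw_map x) = x"
  by (cases x) (auto simp: ccw_map_def ccw_inv_def)

lemma ccw_ccw_inv [simp]: "ccw_map (ccw_inv x) = x"
  by (cases x) (auto simp: ccw_map_def ccw_inv_def)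

lemma cw_inv_cw [simp]: "cw_inv (cw_map x) = x"
  by (cases x) (auto simp: cw_map_def cw_inv_def)

lemma cw_cw_inv [simp]: "cw_map (cw_inv x) = x"
  by (cases x) (auto simp: cw_map_def cw_inv_def)

lemma inv_ccw: "inv ccw_map = ccw_inv"
  by (rule inv_unique_comp) (auto simp: fun_eq_iff)

lemma inv_cw: "inv cw_map = cw_inv"
  by (rule inv_unique_comp) (auto simp: fun_eq_iff)

lemma bij_ccw_inv: "bij ccw_inv"
  by (rule o_bij[where g = ccw_map]) (auto simp: fun_eq_iff)

lemma bij_cw_inv: "bij cw_inv"
  by (rule o_bij[where g = cw_map]) (auto simp: fun_eq_iff)

text \<open>At the sites \<open>y\<close> and \<open>partner y\<close> the operator \<open>S(\<phi>)\<close> mixes the same two values of the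
  wave function, so unitarity survives when the angle varies from one such pair to the next.\<close>

definition partner :: "site \<Rightarrow> site" where
  "partner y = ccw_map (cw_inv y)"

lemma partner_partner [simp]: "partner (partner y) = y"
  by (cases y) (auto simp: partner_def ccw_map_def cw_inv_def)

lemma ccw_inv_partner [simp]: "ccw_inv (partner y) = cw_inv y"
  by (simp add: partner_def)

lemma cw_inv_partner [simp]: "cw_inv (partner y) = ccw_inv y"
  by (metis ccw_inv_partner partner_partner)

lemma cw_map_ccw_inv: "cw_map (ccw_inv y) = partner y"
  by (metis cw_inv_partner cw_cw_inv)

lemma bij_partner: "bij partner"
  by (rule o_bij[where g = partner]) (auto simp: fun_eq_iff)

type_synonym wave = "site \<Rightarrow> complex"

definition hop :: "(site \<Rightarrow> real) \<Rightarrow> wave \<Rightarrow> wave \<Rightarrow> wave" where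
  "hop \<theta> \<omega> \<psi> y = \<omega> y * (complex_of_real (cos (\<theta> y)) * \<psi> (ccw_inv y)
                       + \<i> * complex_of_real (sin (\<theta> y)) * \<psi> (cw_inv y))"

text \<open>The adjoint of \<open>hop\<close>, with division by the phase in place of its conjugate;
  the two agree for unimodular phases.\<close>

definition hop_inv :: "(site \<Rightarrow> real) \<Rightarrow> wave \<Rightarrow> wave \<Rightarrow> wave" where
  "hop_inv \<theta> \<omega> \<psi> x =
     complex_of_real (cos (\<theta> (ccw_map x))) * (\<psi> (ccw_map x) / \<omega> (ccw_map x))
     - \<i> * complex_of_real (sin (\<theta> (cw_map x))) * (\<psi> (cw_map x) / \<omega> (cw_map x))"

definition unimod :: "wave \<Rightarrow> bool" where
  "unimod \<omega> \<longleftrightarrow> (\<forall>y. norm (\<omega> y) = 1)"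

definition paired :: "(site \<Rightarrow> real) \<Rightarrow> bool" where
  "paired \<theta> \<longleftrightarrow> (\<forall>y. \<theta> (partner y) = \<theta> y)"

lemma U_op_eq_hop: "U_op \<omega> \<phi> = hop (\<lambda>_. \<phi>) \<omega>"
  by (simp add: fun_eq_iff U_op_def S_op_def perm_op_def hop_def inv_ccw inv_cw)

lemma hop_add: "hop \<theta> \<omega> (\<lambda>x. \<psi> x + \<xi> x) y = hop \<theta> \<omega> \<psi> y + hop \<theta> \<omega> \<xi> y"
  by (simp add: hop_def algebra_simps)

lemma hop_cmult: "hop \<theta> \<omega> (\<lambda>x. k * \<psi> x) y = k * hop \<theta> \<omega> \<psi> y"
  by (simp add: hop_def algebra_simps)

lemma hop_inv_cmult: "hop_inv \<theta> \<omega> (\<lambda>x. k * \<psi> x) y = k * hop_inv \<theta> \<omega> \<psi> y"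
  by (simp add: hop_inv_def algebra_simps)

text \<open>At \<open>y\<close> the two terms in \<open>\<psi> (partner y)\<close> cancel because
  both members of the pair carry the same angle; what remains has the coefficient cos^2 +
  sin^2.\<close>

lemma hop_hop_inv:
  assumes "unimod \<omega>" "paired \<theta>"
  shows "hop \<theta> \<omega> (hop_inv \<theta> \<omega> \<psi>) = \<psi>"
proof
  fix y
  have nz: "\<omega> t \<noteq> 0" for t
    using assms(1) unfolding unimod_def by (metis norm_zero zero_neq_one)
  have \<theta>: "\<theta> (partner y) = \<theta> y" using assms(2) by (simp add: paired_def)
  let ?c = "complex_of_real (cos (\<theta> y))" and ?s = "complex_of_real (sin (\<theta> y))"
  let ?p = "\<psi> (partner y) / \<omega> (partner y)" and ?q = "\<psi> y / \<omega> y"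
  have "hop \<theta> \<omega> (hop_inv \<theta> \<omega> \<psi>) y
      = \<omega> y * (?c * (?c * ?q - \<i> * ?s * ?p) + \<i> * ?s * (?c * ?p - \<i> * ?s * ?q))"
    by (simp add: hop_def hop_inv_def cw_map_ccw_inv partner_def[symmetric] \<theta>)
  also have "\<dots> = \<omega> y * ((?c\<^sup>2 + ?s\<^sup>2) * ?q)"
    by (simp add: algebra_simps power2_eq_square)
  also have "?c\<^sup>2 + ?s\<^sup>2 = 1"
    by (simp flip: of_real_power of_real_add)
  finally show "hop \<theta> \<omega> (hop_inv \<theta> \<omega> \<psi>) y = \<psi> y" using nz by simp
qed

text \<open>With values in \<open>ennreal\<close>, reindexing by bijections and norm conservation
  hold for every wave, before anything is known to be summable.\<close>

definition l2_sq :: "wave \<Rightarrow> ennreal" where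
  "l2_sq \<psi> = (\<integral>\<^sup>+ x. ennreal ((norm (\<psi> x))\<^sup>2) \<partial>count_space UNIV)"

lemma in_l2_iff: "in_l2 \<psi> \<longleftrightarrow> l2_sq \<psi> < \<infinity>"
proof -
  let ?g = "\<lambda>x. (norm (\<psi> x))\<^sup>2"
  have "in_l2 \<psi> \<longleftrightarrow> Infinite_Set_Sum.abs_summable_on ?g UNIV"
    unfolding in_l2_def abs_summable_equivalent[symmetric] by simp
  also have "\<dots> \<longleftrightarrow> l2_sq \<psi> < \<infinity>"
    by (simp add: abs_summable_on_def integrable_iff_bounded l2_sq_def)
  finally show ?thesis .
qed

lemma rotation_norm:
  fixes a b :: complex and t :: real
  shows "(norm (complex_of_real (cos t) * a + \<i> * complex_of_real (sin t) * b))\<^sup>2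
       + (norm (complex_of_real (cos t) * b + \<i> * complex_of_real (sin t) * a))\<^sup>2
       = (norm a)\<^sup>2 + (norm b)\<^sup>2"
proof -
  have "(norm (complex_of_real p * a + \<i> * complex_of_real q * b))\<^sup>2
       + (norm (complex_of_real p * b + \<i> * complex_of_real q * a))\<^sup>2
       = (p\<^sup>2 + q\<^sup>2) * ((norm a)\<^sup>2 + (norm b)\<^sup>2)" for p q :: real
    unfolding cmod_power2 by (simp add: algebra_simps power2_eq_square)
  then show ?thesis by simp
qed

text \<open>The values at \<open>y\<close> and \<open>partner y\<close> arise from those at
  \<open>ccw_inv y\<close> and \<open>cw_inv y\<close> by a unitary 2x2 block. Summing the block
  identity over all \<open>y\<close> counts every site twice on both sides, and the factor 2
  cancels.\<close>

lemma l2_sq_hop: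
  assumes "unimod \<omega>" "paired \<theta>"
  shows "l2_sq (hop \<theta> \<omega> \<psi>) = l2_sq \<psi>"
proof -
  let ?n = "\<lambda>\<xi> y. ennreal ((norm (\<xi> y :: complex))\<^sup>2)"
  have bij: "(\<integral>\<^sup>+ y. ?n \<xi> (p y) \<partial>count_space UNIV) = l2_sq \<xi>" if "bij p" for \<xi> p
    unfolding l2_sq_def using that by (rule nn_integral_bij_count_space)
  have pt: "?n (hop \<theta> \<omega> \<psi>) y + ?n (hop \<theta> \<omega> \<psi>) (partner y) = ?n \<psi> (ccw_inv y) + ?n \<psi> (cw_inv y)" for y
  proof -
    have "\<theta> (partner y) = \<theta> y" "norm (\<omega> y) = 1" "norm (\<omega> (partner y)) = 1"
      using assms by (simp_all add: paired_def unimod_def)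
    then show ?thesis
      using rotation_norm[of "\<theta> y" "\<psi> (ccw_inv y)" "\<psi> (cw_inv y)"]
      by (simp add: hop_def norm_mult flip: ennreal_plus)
  qed
  have "l2_sq (hop \<theta> \<omega> \<psi>) + l2_sq (hop \<theta> \<omega> \<psi>)
      = (\<integral>\<^sup>+ y. ?n (hop \<theta> \<omega> \<psi>) y + ?n (hop \<theta> \<omega> \<psi>) (partner y) \<partial>count_space UNIV)"
    by (simp add: nn_integral_add bij[OF bij_partner] l2_sq_def[symmetric])
  also have "\<dots> = (\<integral>\<^sup>+ y. ?n \<psi> (ccw_inv y) + ?n \<psi> (cw_inv y) \<partial>count_space UNIV)"
    by (simp only: pt)
  also have "\<dots> = l2_sq \<psi> + l2_sq \<psi>"
    by (simp add: nn_integral_add bij[OF bij_ccw_inv] bij[OF bij_cw_inv])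
  finally have "l2_sq (hop \<theta> \<omega> \<psi>) + l2_sq (hop \<theta> \<omega> \<psi>) = l2_sq \<psi> + l2_sq \<psi>" .
  then have "2 * l2_sq (hop \<theta> \<omega> \<psi>) = 2 * l2_sq \<psi>" by (simp add: mult_2)
  then show ?thesis by (simp add: ennreal_mult_cancel_left)
qed

lemma l2_sq_hop_inv:
  assumes "unimod \<omega>" "paired \<theta>"
  shows "l2_sq (hop_inv \<theta> \<omega> \<psi>) = l2_sq \<psi>"
  using l2_sq_hop[OF assms, of "hop_inv \<theta> \<omega> \<psi>"] by (simp add: hop_hop_inv[OF assms])

lemma in_l2_add:
  assumes "in_l2 \<psi>" "in_l2 \<xi>"
  shows "in_l2 (\<lambda>x. \<psi> x + \<xi> x)"
  unfolding in_l2_def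
proof (rule summable_on_comparison_test)
  show "(\<lambda>x. 2 * (norm (\<psi> x))\<^sup>2 + 2 * (norm (\<xi> x))\<^sup>2) summable_on UNIV"
    using assms unfolding in_l2_def by (intro summable_on_add summable_on_cmult_right)
  show "(norm (\<psi> x + \<xi> x))\<^sup>2 \<le> 2 * (norm (\<psi> x))\<^sup>2 + 2 * (norm (\<xi> x))\<^sup>2" for x
  proof -
    have "(norm (\<psi> x + \<xi> x))\<^sup>2 \<le> (norm (\<psi> x) + norm (\<xi> x))\<^sup>2"
      by (intro power_mono norm_triangle_ineq) auto
    also have "\<dots> \<le> 2 * (norm (\<psi> x))\<^sup>2 + 2 * (norm (\<xi> x))\<^sup>2"
      using sum_squares_bound[of "norm (\<psi> x)" "norm (\<xi> x)"] by (simp add: power2_sum)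
    finally show ?thesis .
  qed
qed auto

lemma in_l2_cmult: "in_l2 \<psi> \<Longrightarrow> in_l2 (\<lambda>x. k * \<psi> x)"
  unfolding in_l2_def by (simp add: norm_mult power_mult_distrib summable_on_cmult_right)

lemma in_l2_mono:
  assumes "in_l2 \<psi>" "\<And>x. norm (\<xi> x) \<le> norm (\<psi> x)"
  shows "in_l2 \<xi>"
  using assms unfolding in_l2_def
  by (auto intro!: summable_on_comparison_test[of "\<lambda>x. (norm (\<psi> x))\<^sup>2"] power_mono)

lemma in_l2_hop:
  assumes "unimod \<omega>" "paired \<theta>" "in_l2 \<psi>"
  shows "in_l2 (hop \<theta> \<omega> \<psi>)"
  using assms by (simp add: in_l2_iff l2_sq_hop)

lemma l2_sq_eq_infsum:
  assumes "in_l2 \<psi>"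
  shows "l2_sq \<psi> = ennreal (\<Sum>\<^sub>\<infinity>x. (norm (\<psi> x))\<^sup>2)"
  unfolding l2_sq_def using assms unfolding in_l2_def
  by (subst infsetsum_infsum[symmetric])
     (auto simp: abs_summable_equivalent[symmetric] nn_integral_conv_infsetsum)

text \<open>Unitarity balances the total mass, so its change on \<open>F\<close> is opposite to the change off \<open>F\<close>,
  whose sign is that of \<open>norm z - 1\<close>.\<close>

lemma flux:
  assumes "unimod \<omega>" "paired \<theta>" "in_l2 \<psi>" "finite F"
    and eq: "\<And>y. y \<notin> F \<Longrightarrow> hop \<theta> \<omega> \<psi> y = z * \<psi> y"
  shows "norm z \<ge> 1 \<Longrightarrow> (\<Sum>y\<in>F. (norm (hop \<theta> \<omega> \<psi> y))\<^sup>2) \<le> (\<Sum>y\<in>F. (norm (\<psi> y))\<^sup>2)"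
    and "norm z \<le> 1 \<Longrightarrow> (\<Sum>y\<in>F. (norm (\<psi> y))\<^sup>2) \<le> (\<Sum>y\<in>F. (norm (hop \<theta> \<omega> \<psi> y))\<^sup>2)"
proof -
  let ?h = "\<lambda>y. (norm (hop \<theta> \<omega> \<psi> y))\<^sup>2" and ?p = "\<lambda>y. (norm (\<psi> y))\<^sup>2"
  have sp: "?p summable_on UNIV" using assms(3) by (simp add: in_l2_def)
  have sh: "?h summable_on UNIV" using in_l2_hop[OF assms(1-3)] by (simp add: in_l2_def)
  have "infsum ?h UNIV = infsum ?p UNIV"
    using l2_sq_hop[OF assms(1,2), of \<psi>] l2_sq_eq_infsum[OF assms(3)]
      l2_sq_eq_infsum[OF in_l2_hop[OF assms(1-3)]]
    by (simp add: infsum_nonneg)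
  then have tot: "((\<lambda>y. ?h y - ?p y) has_sum 0) UNIV"
    using has_sum_add[OF has_sum_infsum[OF sh] has_sum_uminusI[OF has_sum_infsum[OF sp]]] by simp
  have fin: "((\<lambda>y. ?h y - ?p y) has_sum (\<Sum>y\<in>F. ?h y - ?p y)) F"
    using assms(4) by (rule has_sum_finite)
  have off: "?h y = (norm z)\<^sup>2 * ?p y" if "y \<notin> F" for y
    using eq[OF that] by (simp add: norm_mult power_mult_distrib)
  show "(\<Sum>y\<in>F. ?h y) \<le> (\<Sum>y\<in>F. ?p y)" if "norm z \<ge> 1"
  proof -
    have "1 * ?p y \<le> (norm z)\<^sup>2 * ?p y" for y
      using that by (intro mult_right_mono) (auto simp: one_le_power)
    then have "(\<Sum>y\<in>F. ?h y - ?p y) \<le> 0"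
      by (intro has_sum_mono_neutral[OF fin tot]) (auto simp: off)
    then show ?thesis by (simp add: sum_subtractf)
  qed
  show "(\<Sum>y\<in>F. ?p y) \<le> (\<Sum>y\<in>F. ?h y)" if "norm z \<le> 1"
  proof -
    have "(norm z)\<^sup>2 * ?p y \<le> 1 * ?p y" for y
      using that by (intro mult_right_mono) (auto simp: power_le_one)
    then have "0 \<le> (\<Sum>y\<in>F. ?h y - ?p y)"
      by (intro has_sum_mono_neutral[OF tot fin]) (auto simp: off)
    then show ?thesis by (simp add: sum_subtractf)
  qed
qed

section \<open>The resolvent equation for general sources, and uniqueness in l2\<close>

definition solves :: "(site \<Rightarrow> real) \<Rightarrow> wave \<Rightarrow> complex \<Rightarrow> wave \<Rightarrow> wave \<Rightarrow> bool" where
  "solves \<theta> \<omega> z \<eta> \<psi> \<longleftrightarrow> in_l2 \<psi> \<and> (\<forall>y. hop \<theta> \<omega> \<psi> y - z * \<psi> y = \<eta> y)"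

definition unit_at :: "site \<Rightarrow> wave" where
  "unit_at \<nu> y = (if y = \<nu> then 1 else 0)"

lemma solves_add: "solves \<theta> \<omega> z \<eta> \<psi> \<Longrightarrow> solves \<theta> \<omega> z \<eta>' \<psi>' \<Longrightarrow>
    solves \<theta> \<omega> z (\<lambda>x. \<eta> x + \<eta>' x) (\<lambda>x. \<psi> x + \<psi>' x)"
  unfolding solves_def by (auto intro: in_l2_add simp: hop_add algebra_simps)

lemma solves_cmult: "solves \<theta> \<omega> z \<eta> \<psi> \<Longrightarrow> solves \<theta> \<omega> z (\<lambda>x. k * \<eta> x) (\<lambda>x. k * \<psi> x)"
  unfolding solves_def by (auto intro: in_l2_cmult simp: hop_cmult algebra_simps)

lemma solves_sum:
  assumes "\<And>i. i \<in> A \<Longrightarrow> solves \<theta> \<omega> z (\<eta> i) (\<psi> i)"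
  shows "solves \<theta> \<omega> z (\<lambda>x. \<Sum>i\<in>A. \<eta> i x) (\<lambda>x. \<Sum>i\<in>A. \<psi> i x)"
  using assms
proof (induction A rule: infinite_finite_induct)
  case (insert i A)
  then show ?case using solves_add[of \<theta> \<omega> z "\<eta> i" "\<psi> i"] by simp
qed (simp_all add: solves_def in_l2_def hop_def)

text \<open>Without a source the equation holds everywhere, so \<open>flux\<close> applies to a
  single site. It then compares |z|^2 times the mass at that site with the mass itself, in the
  direction that |z| forbids unless the mass is 0.\<close>

lemma solves_zero:
  assumes "unimod \<omega>" "paired \<theta>" "norm z \<noteq> 1" "solves \<theta> \<omega> z (\<lambda>_. 0) \<psi>"
  shows "\<psi> = (\<lambda>_. 0)"
proof
  fix y
  have l2: "in_l2 \<psi>" and eq: "hop \<theta> \<omega> \<psi> x = z * \<psi> x" for x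
    using assms(4) by (auto simp: solves_def)
  have nn: "(norm (\<psi> y))\<^sup>2 \<ge> 0" by simp
  show "\<psi> y = 0"
  proof (cases "norm z > 1")
    case True
    then have "(norm z)\<^sup>2 * (norm (\<psi> y))\<^sup>2 \<le> 1 * (norm (\<psi> y))\<^sup>2" "(norm z)\<^sup>2 > 1"
      using flux(1)[OF assms(1,2) l2, of "{y}" z] eq
      by (auto simp: norm_mult power_mult_distrib one_less_power)
    then show ?thesis by (metis mult_le_cancel_right nn not_le norm_eq_zero zero_less_power2 zero_eq_power2 order_le_less)
  next
    case False
    then have "norm z < 1" using assms(3) by simp
    then have "1 * (norm (\<psi> y))\<^sup>2 \<le> (norm z)\<^sup>2 * (norm (\<psi> y))\<^sup>2" "(norm z)\<^sup>2 < 1"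
      using flux(2)[OF assms(1,2) l2, of "{y}" z] eq
      by (auto simp: norm_mult power_mult_distrib power_less_one_iff abs_square_less_1)
    then show ?thesis by (metis mult_le_cancel_right nn not_le norm_eq_zero zero_less_power2 zero_eq_power2 order_le_less)
  qed
qed

lemma solves_unique:
  assumes "unimod \<omega>" "paired \<theta>" "norm z \<noteq> 1" "solves \<theta> \<omega> z \<eta> \<psi>" "solves \<theta> \<omega> z \<eta> \<xi>"
  shows "\<psi> = \<xi>"
proof -
  have "solves \<theta> \<omega> z (\<lambda>x. \<eta> x + (-1) * \<eta> x) (\<lambda>x. \<psi> x + (-1) * \<xi> x)"
    by (intro solves_add solves_cmult assms)
  then have "(\<lambda>x. \<psi> x + (-1) * \<xi> x) = (\<lambda>_. 0)"
    using solves_zero[OF assms(1-3)] by simp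
  then show ?thesis by (auto simp: fun_eq_iff)
qed

section \<open>Neumann series, measurability and resampling\<close>

lemma L2_set_le:
  assumes "l2_sq \<psi> \<le> 1" "finite F"
  shows "L2_set (\<lambda>y. norm (\<psi> y)) F \<le> 1"
proof -
  have l2: "in_l2 \<psi>" using assms(1) by (auto simp: in_l2_iff intro: le_less_trans)
  then have "(\<Sum>y\<in>F. (norm (\<psi> y))\<^sup>2) \<le> (\<Sum>\<^sub>\<infinity>y. (norm (\<psi> y))\<^sup>2)"
    using assms(2) unfolding in_l2_def by (intro finite_sum_le_infsum) auto
  also have "\<dots> \<le> 1"
    using assms(1) l2_sq_eq_infsum[OF l2] by (simp flip: ennreal_1)
  finally show ?thesis by (simp add: L2_set_def)
qed

lemma l2_sq_unit_at: "l2_sq (unit_at \<nu>) = 1"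
proof -
  have "l2_sq (unit_at \<nu>) = (\<integral>\<^sup>+ x. indicator {\<nu>} x \<partial>count_space UNIV)"
    unfolding l2_sq_def by (intro nn_integral_cong) (auto simp: unit_at_def indicator_def)
  then show ?thesis by simp
qed

text \<open>The series for the inverse of 1 - k T applied to a basis vector, summed site by site.
  Each partial sum involves finitely many phases, which gives measurability in \<omega>
  directly.\<close>

definition neumann :: "(wave \<Rightarrow> wave) \<Rightarrow> complex \<Rightarrow> site \<Rightarrow> wave" where
  "neumann T k \<nu> y = (\<Sum>n. k ^ n * (T ^^ n) (unit_at \<nu>) y)"

lemma l2_sq_iterate:
  assumes "\<And>\<psi>. l2_sq (T \<psi>) = l2_sq \<psi>"
  shows "l2_sq ((T ^^ n) (unit_at \<nu>)) = 1"
  by (induction n) (simp_all add: assms l2_sq_unit_at)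

lemma neumann_sums:
  assumes T: "\<And>\<psi>. l2_sq (T \<psi>) = l2_sq \<psi>" and k: "norm k < 1"
  shows "(\<lambda>n. k ^ n * (T ^^ n) (unit_at \<nu>) y) sums neumann T k \<nu> y"
  unfolding neumann_def
proof (rule summable_sums, rule summable_comparison_test')
  show "summable (\<lambda>n. norm k ^ n)" using k by (simp add: summable_geometric)
  fix n
  have "norm ((T ^^ n) (unit_at \<nu>) y) \<le> 1"
    using L2_set_le[of "(T ^^ n) (unit_at \<nu>)" "{y}"] l2_sq_iterate[OF T] by simp
  then show "norm (k ^ n * (T ^^ n) (unit_at \<nu>) y) \<le> norm k ^ n"
    by (simp add: norm_mult norm_power mult_left_le)
qed

text \<open>Minkowski's inequality on a finite set bounds the partial sums by a geometric series,
  uniformly in the set and in the number of terms. Let the number of terms grow first, then the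
  set.\<close>

lemma in_l2_neumann:
  assumes T: "\<And>\<psi>. l2_sq (T \<psi>) = l2_sq \<psi>" and k: "norm k < 1"
  shows "in_l2 (neumann T k \<nu>)"
proof -
  let ?t = "\<lambda>n. (T ^^ n) (unit_at \<nu>)"
  let ?M = "1 / (1 - norm k)"
  have part: "L2_set (\<lambda>y. norm (\<Sum>n<N. k ^ n * ?t n y)) F \<le> (\<Sum>n<N. norm k ^ n)" if "finite F" for F N
  proof (induction N)
    case (Suc N)
    have "L2_set (\<lambda>y. norm (\<Sum>n<Suc N. k ^ n * ?t n y)) F
        \<le> L2_set (\<lambda>y. norm (\<Sum>n<N. k ^ n * ?t n y) + norm (k ^ N) * norm (?t N y)) F"
      by (intro L2_set_mono) (auto simp flip: norm_mult intro: norm_triangle_ineq)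
    also have "\<dots> \<le> L2_set (\<lambda>y. norm (\<Sum>n<N. k ^ n * ?t n y)) F
        + L2_set (\<lambda>y. norm (k ^ N) * norm (?t N y)) F"
      by (rule L2_set_triangle_ineq)
    also have "L2_set (\<lambda>y. norm (k ^ N) * norm (?t N y)) F = norm (k ^ N) * L2_set (\<lambda>y. norm (?t N y)) F"
      by (simp add: L2_set_right_distrib)
    also have "\<dots> \<le> norm (k ^ N) * 1"
      using L2_set_le[OF _ that, of "?t N"] l2_sq_iterate[OF T] by (intro mult_left_mono) auto
    finally show ?case using Suc by (simp add: norm_power)
  qed (simp add: L2_set_def)
  have bound: "(\<Sum>y\<in>F. (norm (neumann T k \<nu> y))\<^sup>2) \<le> ?M\<^sup>2" if F: "finite F" for F
  proof (rule LIMSEQ_le_const2)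
    show "(\<lambda>N. \<Sum>y\<in>F. (norm (\<Sum>n<N. k ^ n * ?t n y))\<^sup>2) \<longlonglongrightarrow> (\<Sum>y\<in>F. (norm (neumann T k \<nu> y))\<^sup>2)"
      using neumann_sums[OF T k] unfolding sums_def by (intro tendsto_intros)
    have "(\<Sum>y\<in>F. (norm (\<Sum>n<N. k ^ n * ?t n y))\<^sup>2) \<le> ?M\<^sup>2" for N
    proof -
      have "(\<Sum>y\<in>F. (norm (\<Sum>n<N. k ^ n * ?t n y))\<^sup>2) = (L2_set (\<lambda>y. norm (\<Sum>n<N. k ^ n * ?t n y)) F)\<^sup>2"
        by (simp add: L2_set_def sum_nonneg)
      also have "\<dots> \<le> (\<Sum>n<N. norm k ^ n)\<^sup>2"
        using part[OF F] by (intro power_mono) auto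
      also have "\<dots> \<le> ?M\<^sup>2"
      proof (intro power_mono)
        have "(\<Sum>n<N. norm k ^ n) \<le> (\<Sum>n. norm k ^ n)"
          using k by (intro sum_le_suminf) (auto simp: summable_geometric)
        then show "(\<Sum>n<N. norm k ^ n) \<le> ?M" using k by (simp add: suminf_geometric)
      qed (auto intro: sum_nonneg)
      finally show ?thesis .
    qed
    then show "\<exists>N. \<forall>n\<ge>N. (\<Sum>y\<in>F. (norm (\<Sum>i<n. k ^ i * ?t i y))\<^sup>2) \<le> ?M\<^sup>2" by blast
  qed
  show ?thesis
    unfolding in_l2_def
    by (rule nonneg_bdd_above_summable_on) (auto intro!: bdd_aboveI[of _ "?M\<^sup>2"] bound)
qed

text \<open>Applying k T shifts the series by one index, so only the zeroth term survives in the
  difference. The hypothesis \<open>cont\<close> asks for pointwise convergence only, because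
  \<open>hop\<close> and \<open>hop_inv\<close> read just two values at each site.\<close>

lemma neumann_fixed_point:
  assumes T: "\<And>\<psi>. l2_sq (T \<psi>) = l2_sq \<psi>" and k: "norm k < 1"
    and lin: "\<And>c \<psi> y. T (\<lambda>x. c * \<psi> x) y = c * T \<psi> y"
    and cont: "\<And>\<psi> \<xi> y. (\<And>x. (\<lambda>n. \<psi> n x) sums \<xi> x) \<Longrightarrow> (\<lambda>n. T (\<psi> n) y) sums T \<xi> y"
  shows "neumann T k \<nu> y - k * T (neumann T k \<nu>) y = unit_at \<nu> y"
proof -
  let ?t = "\<lambda>n. (T ^^ n) (unit_at \<nu>)"
  have "(\<lambda>n. T (\<lambda>x. k ^ n * ?t n x) y) sums T (neumann T k \<nu>) y"
    by (rule cont) (rule neumann_sums[OF T k])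
  then have "(\<lambda>n. k * (k ^ n * ?t (Suc n) y)) sums (k * T (neumann T k \<nu>) y)"
    by (intro sums_mult) (simp add: lin)
  then have "(\<lambda>n. k ^ Suc n * ?t (Suc n) y) sums (k * T (neumann T k \<nu>) y)"
    by (simp add: mult.assoc)
  then have "(\<lambda>n. k ^ n * ?t n y) sums (k * T (neumann T k \<nu>) y + unit_at \<nu> y)"
    by (subst (asm) sums_Suc_iff) simp
  from sums_unique2[OF this neumann_sums[OF T k]] show ?thesis by (simp add: algebra_simps)
qed

lemma hop_sums:
  assumes "\<And>x. (\<lambda>n. \<psi> n x) sums \<xi> x"
  shows "(\<lambda>n. hop \<theta> \<omega> (\<psi> n) y) sums hop \<theta> \<omega> \<xi> y"
  unfolding hop_def by (intro sums_mult sums_add assms)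

lemma hop_inv_sums:
  assumes "\<And>x. (\<lambda>n. \<psi> n x) sums \<xi> x"
  shows "(\<lambda>n. hop_inv \<theta> \<omega> (\<psi> n) y) sums hop_inv \<theta> \<omega> \<xi> y"
  unfolding hop_inv_def by (intro sums_mult sums_diff sums_divide assms)

text \<open>The column of the resolvent with source \<nu>: for |z| > 1 from U - z = -z (1 - U/z),
  otherwise from U - z = (1 - z U^-1) U. On |z| = 1 the value has no meaning.\<close>

definition green :: "(site \<Rightarrow> real) \<Rightarrow> wave \<Rightarrow> complex \<Rightarrow> site \<Rightarrow> wave" where
  "green \<theta> \<omega> z \<nu> \<mu> =
     (if norm z > 1 then - (1 / z) * neumann (hop \<theta> \<omega>) (1 / z) \<nu> \<mu>
      else hop_inv \<theta> \<omega> (neumann (hop_inv \<theta> \<omega>) z \<nu>) \<mu>)"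

lemma solves_green:
  assumes "unimod \<omega>" "paired \<theta>" "norm z \<noteq> 1"
  shows "solves \<theta> \<omega> z (unit_at \<nu>) (green \<theta> \<omega> z \<nu>)"
proof (cases "norm z > 1")
  case True
  let ?N = "neumann (hop \<theta> \<omega>) (1 / z) \<nu>"
  have k: "norm (1 / z) < 1" and z: "z \<noteq> 0"
    using True by (auto simp: norm_divide divide_less_eq)
  have g: "green \<theta> \<omega> z \<nu> = (\<lambda>x. - (1 / z) * ?N x)"
    using True by (simp add: green_def fun_eq_iff)
  have "?N y - 1 / z * hop \<theta> \<omega> ?N y = unit_at \<nu> y" for y
    using l2_sq_hop[OF assms(1,2)] k hop_cmult hop_sums by (rule neumann_fixed_point)
  moreover have "in_l2 ?N"
    using l2_sq_hop[OF assms(1,2)] k by (rule in_l2_neumann)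
  moreover have "hop \<theta> \<omega> (\<lambda>x. - (1 / z) * ?N x) y - z * (- (1 / z) * ?N y)
      = ?N y - 1 / z * hop \<theta> \<omega> ?N y" for y
    using z by (simp only: hop_cmult) simp
  ultimately show ?thesis
    unfolding solves_def g by (metis in_l2_cmult)
next
  case False
  let ?N = "neumann (hop_inv \<theta> \<omega>) z \<nu>"
  have k: "norm z < 1" using False assms(3) by simp
  have g: "green \<theta> \<omega> z \<nu> = hop_inv \<theta> \<omega> ?N"
    using False by (simp add: green_def fun_eq_iff)
  have "?N y - z * hop_inv \<theta> \<omega> ?N y = unit_at \<nu> y" for y
    using l2_sq_hop_inv[OF assms(1,2)] k hop_inv_cmult hop_inv_sums by (rule neumann_fixed_point)
  moreover have "in_l2 ?N"
    using l2_sq_hop_inv[OF assms(1,2)] k by (rule in_l2_neumann)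
  ultimately show ?thesis
    unfolding solves_def g using assms
    by (simp add: hop_hop_inv in_l2_iff l2_sq_hop_inv)
qed

lemma green_eqI:
  assumes "unimod \<omega>" "paired \<theta>" "norm z \<noteq> 1" "solves \<theta> \<omega> z (unit_at \<nu>) \<psi>"
  shows "green \<theta> \<omega> z \<nu> = \<psi>"
  using solves_unique[OF assms(1-3) solves_green[OF assms(1-3)] assms(4)] .

lemma resolvent_entry_eq_green:
  assumes "unimod \<omega>" "norm z \<noteq> 1"
  shows "resolvent_entry \<omega> \<phi> z \<mu> \<nu> = green (\<lambda>_. \<phi>) \<omega> z \<nu> \<mu>"
proof -
  have p: "paired (\<lambda>_. \<phi>)" by (simp add: paired_def)
  have "(THE \<psi>. in_l2 \<psi> \<and> (\<forall>y. U_op \<omega> \<phi> \<psi> y - z * \<psi> y = (if y = \<nu> then 1 else 0)))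
      = (THE \<psi>. solves (\<lambda>_. \<phi>) \<omega> z (unit_at \<nu>) \<psi>)"
    by (simp add: solves_def U_op_eq_hop unit_at_def)
  also have "\<dots> = green (\<lambda>_. \<phi>) \<omega> z \<nu>"
    using solves_green[OF assms(1) p assms(2)] green_eqI[OF assms(1) p assms(2)]
    by (intro the_equality) auto
  finally show ?thesis by (simp add: resolvent_entry_def)
qed

section \<open>The product space of random phases\<close>

lemma sets_circle [measurable_cong]: "sets circle_measure = sets borel"
  by (simp add: circle_measure_def)

lemma measurable_cis [measurable]: "cis \<in> borel_measurable (uniform_measure lborel {0..2*pi})"
  by (simp add: borel_measurable_continuous_onI continuous_on_cis cong: measurable_cong_sets)

lemma prob_space_circle: "prob_space circle_measure"
  unfolding circle_measure_def
proof (rule prob_space.prob_space_distr)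
  show "prob_space (uniform_measure lborel {0..2*pi})"
    by (rule prob_space_uniform_measure) auto
qed measurable

lemma AE_circle_norm: "AE w in circle_measure. norm w = 1"
  unfolding circle_measure_def by (subst AE_distr_iff) auto

lemma measurable_phase: "(\<lambda>\<omega>. \<omega> y) \<in> borel_measurable Pomega"
proof -
  have "(\<lambda>\<omega>. \<omega> y) \<in> measurable Pomega circle_measure"
    unfolding Pomega_def by (rule measurable_component_singleton) simp
  then show ?thesis by (simp add: measurable_cong_sets[OF refl sets_circle])
qed

lemma prob_space_Pomega: "prob_space Pomega"
  unfolding Pomega_def by (intro prob_space_PiM prob_space_circle)

text \<open>The coordinates range over all complex numbers, so unimodularity is only an almost sure
  event; countability of the sites allows all coordinates to be treated at once.\<close>

lemma AE_unimod: "AE \<omega> in Pomega. unimod \<omega>"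
  unfolding unimod_def AE_all_countable Pomega_def
  by (intro allI AE_PiM_component prob_space_circle AE_circle_norm) auto

lemma measurable_neumann:
  assumes T: "\<And>(\<psi> :: wave \<Rightarrow> wave) y. (\<And>x. (\<lambda>\<omega>. \<psi> \<omega> x) \<in> borel_measurable Pomega) \<Longrightarrow>
       (\<lambda>\<omega>. T \<omega> (\<psi> \<omega>) y) \<in> borel_measurable Pomega"
  shows "(\<lambda>\<omega>. neumann (T \<omega>) k \<nu> y) \<in> borel_measurable Pomega"
proof -
  have [measurable]: "(\<lambda>\<omega>. (T \<omega> ^^ n) (unit_at \<nu>) x) \<in> borel_measurable Pomega" for n x
    by (induction n arbitrary: x) (simp_all add: T)
  show ?thesis unfolding neumann_def by measurable
qed

lemma measurable_green [measurable]:
  "(\<lambda>\<omega>. green \<theta> \<omega> z \<nu> \<mu>) \<in> borel_measurable Pomega"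
proof -
  note [measurable] = measurable_phase
  have hop: "(\<lambda>\<omega>. hop \<theta> \<omega> (\<psi> \<omega>) y) \<in> borel_measurable Pomega"
    if [measurable]: "\<And>x. (\<lambda>\<omega>. \<psi> \<omega> x) \<in> borel_measurable Pomega" for \<psi> y
    unfolding hop_def by measurable
  have inv: "(\<lambda>\<omega>. hop_inv \<theta> \<omega> (\<psi> \<omega>) y) \<in> borel_measurable Pomega"
    if [measurable]: "\<And>x. (\<lambda>\<omega>. \<psi> \<omega> x) \<in> borel_measurable Pomega" for \<psi> y
    unfolding hop_inv_def by measurable
  have [measurable]: "(\<lambda>\<omega>. neumann (hop \<theta> \<omega>) k \<nu> y) \<in> borel_measurable Pomega" for k y
    by (rule measurable_neumann) (rule hop)
  have [measurable]: "(\<lambda>\<omega>. hop_inv \<theta> \<omega> (neumann (hop_inv \<theta> \<omega>) k \<nu>) y) \<in> borel_measurable Pomega" for k y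
    by (rule inv, rule measurable_neumann) (rule inv)
  show ?thesis unfolding green_def by measurable
qed

lemma measurable_fun_upd_Pomega:
  "(\<lambda>(w, \<omega>). fun_upd \<omega> x w) \<in> measurable (circle_measure \<Otimes>\<^sub>M Pomega) Pomega"
  unfolding Pomega_def
  by (rule measurable_PiM_single') (auto simp: space_PiM circle_measure_def split_beta')

text \<open>The product law does not change when one coordinate is replaced by an independent copy.
  This takes the place of conditional expectation given the other phases.\<close>

lemma nn_integral_resample:
  assumes [measurable]: "f \<in> borel_measurable Pomega"
  shows "(\<integral>\<^sup>+ \<omega>. f \<omega> \<partial>Pomega) = (\<integral>\<^sup>+ \<omega>. \<integral>\<^sup>+ w. f (fun_upd \<omega> x w) \<partial>circle_measure \<partial>Pomega)"
proof -
  interpret C: prob_space circle_measure by (rule prob_space_circle)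
  interpret P: prob_space Pomega by (rule prob_space_Pomega)
  interpret CP: pair_sigma_finite circle_measure Pomega ..
  note [measurable] = measurable_fun_upd_Pomega
  have "Pomega = distr (circle_measure \<Otimes>\<^sub>M Pomega) Pomega (\<lambda>(w, \<omega>). fun_upd \<omega> x w)"
    using distr_pair_PiM_eq_PiM[of UNIV "\<lambda>_. circle_measure" x] prob_space_circle
    by (simp add: Pomega_def)
  then have "(\<integral>\<^sup>+ \<omega>. f \<omega> \<partial>Pomega)
      = (\<integral>\<^sup>+ \<omega>. f \<omega> \<partial>distr (circle_measure \<Otimes>\<^sub>M Pomega) Pomega (\<lambda>(w, \<omega>). fun_upd \<omega> x w))"
    by simp
  also have "\<dots> = (\<integral>\<^sup>+ p. f (fun_upd (snd p) x (fst p)) \<partial>(circle_measure \<Otimes>\<^sub>M Pomega))"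
    by (subst nn_integral_distr) (auto simp: split_beta' measurable_fun_upd_Pomega)
  also have "\<dots> = (\<integral>\<^sup>+ \<omega>. \<integral>\<^sup>+ w. f (fun_upd \<omega> x w) \<partial>circle_measure \<partial>Pomega)"
    using measurable_compose[OF measurable_fun_upd_Pomega assms, of x]
    by (subst CP.nn_integral_snd[symmetric]) (auto simp: split_beta')
  finally show ?thesis .
qed

section \<open>Fractional moments on the circle\<close>

text \<open>With x = t/2, the inequality x cos x \<le> sin x and the double angle formula give sin t
  \<ge> 2 x (cos x)^2 = x (1 + cos t) \<ge> x.\<close>

lemma half_le_sin:
  fixes t :: real
  assumes "0 \<le> t" "t \<le> pi / 2"
  shows "t / 2 \<le> sin t"
proof -
  define x where "x = t / 2"
  have x: "0 \<le> x" "x \<le> pi / 4" using assms by (auto simp: x_def)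
  have "(\<lambda>x. sin x - x * cos x) 0 \<le> (\<lambda>x. sin x - x * cos x) x"
  proof (rule DERIV_nonneg_imp_nondecreasing[OF x(1)])
    fix y :: real assume y: "0 \<le> y" "y \<le> x"
    have "((\<lambda>x. sin x - x * cos x) has_real_derivative y * sin y) (at y)"
      by (auto intro!: derivative_eq_intros)
    moreover have "0 \<le> y * sin y"
      using y x by (intro mult_nonneg_nonneg sin_ge_zero) auto
    ultimately show "\<exists>d. ((\<lambda>x. sin x - x * cos x) has_real_derivative d) (at y) \<and> 0 \<le> d" by blast
  qed
  then have "x * cos x \<le> sin x" by simp
  moreover have "0 \<le> cos x" using x by (intro cos_ge_zero) auto
  ultimately have "2 * (x * cos x * cos x) \<le> 2 * (sin x * cos x)"
    by (intro mult_left_mono mult_right_mono) auto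
  also have "\<dots> = sin t" using sin_double[of x] by (simp add: x_def)
  finally have "2 * (x * cos x * cos x) \<le> sin t" .
  moreover have "2 * (x * cos x * cos x) = x * (1 + cos t)"
    using cos_double_cos[of x] by (simp add: x_def power2_eq_square)
  moreover have "x * 1 \<le> x * (1 + cos t)"
    using assms x by (intro mult_left_mono) (auto intro: cos_ge_zero)
  ultimately have "x \<le> sin t" by linarith
  then show ?thesis by (simp add: x_def)
qed

text \<open>Rotating \<open>a\<close> onto the real axis, the distance is at least the imaginary
  part |sin (t - Arg a)|, and the sine is compared with the distance to the nearest multiple of
  \<pi>. As t - Arg a lies between -\<pi> and 3\<pi>, five multiples suffice, whatever the modulus
  of \<open>a\<close>.\<close>

lemma cis_dist_lower_bound:
  assumes "0 \<le> t" "t \<le> 2 * pi"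
  shows "\<exists>k\<in>{-1..3::int}. \<bar>t - (Arg a + of_int k * pi)\<bar> / 2 \<le> norm (cis t - a)"
proof -
  define u where "u = t - Arg a"
  define k where "k = round (u / pi)"
  have "-1 \<le> u / pi" "u / pi \<le> 3"
    using assms Arg_bounded[of a] by (auto simp: u_def field_simps)
  then have k: "k \<in> {-1..3}"
    unfolding k_def round_def atLeastAtMost_iff le_floor_iff floor_le_iff by simp
  define v where "v = u - of_int k * pi"
  have "\<bar>of_int k - u / pi\<bar> \<le> 1 / 2"
    unfolding k_def using of_int_round_abs_le by blast
  then have "\<bar>of_int k - u / pi\<bar> * pi \<le> 1 / 2 * pi" by (intro mult_right_mono) auto
  also have "\<bar>of_int k - u / pi\<bar> * pi = \<bar>v\<bar>"
  proof -
    have "\<bar>of_int k - u / pi\<bar> * pi = \<bar>(of_int k - u / pi) * pi\<bar>" by (simp add: abs_mult)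
    also have "(of_int k - u / pi) * pi = - v" by (simp add: v_def algebra_simps)
    finally show ?thesis by simp
  qed
  finally have v: "\<bar>v\<bar> \<le> pi / 2" by simp
  have "\<bar>v\<bar> / 2 \<le> sin \<bar>v\<bar>" using v by (intro half_le_sin) auto
  also have "\<dots> \<le> \<bar>sin v\<bar>" by (cases "v \<ge> 0") auto
  also have "\<bar>sin v\<bar> = \<bar>sin u\<bar>"
  proof -
    have "sin v = sin u * cos (of_int k * pi)"
      using sin_npi_int[of k] by (simp add: v_def sin_diff mult.commute)
    moreover have "\<bar>cos (of_int k * pi)\<bar> = 1"
    proof -
      have "(cos (of_int k * pi))\<^sup>2 = 1"
        using sin_cos_squared_add[of "of_int k * pi"] sin_npi_int[of k] by (simp add: mult.commute)
      then show ?thesis by (simp add: abs_square_eq_1)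
    qed
    ultimately show ?thesis by (simp add: abs_mult)
  qed
  also have "\<bar>sin u\<bar> = \<bar>Im ((cis t - a) * cis (- Arg a))\<bar>"
  proof -
    have "a * cis (- Arg a) = of_real (norm a)"
    proof -
      have "of_real (norm a) * cis (Arg a) = a" using rcis_cmod_Arg[of a] by (simp add: rcis_def)
      then have "a * cis (- Arg a) = of_real (norm a) * (cis (Arg a) * cis (- Arg a))"
        by (metis mult.assoc)
      then show ?thesis by (simp add: cis_mult)
    qed
    then show ?thesis by (simp add: left_diff_distrib cis_mult u_def)
  qed
  also have "\<dots> \<le> norm ((cis t - a) * cis (- Arg a))" by (rule abs_Im_le_cmod)
  also have "\<dots> = norm (cis t - a)" by (simp add: norm_mult)
  finally show ?thesis using k by (intro bexI[of _ k]) (auto simp: v_def u_def algebra_simps)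
qed

text \<open>The reciprocal is taken in \<open>ennreal\<close>, so that it is infinite rather than zero at \<open>0\<close>.\<close>

definition rpow :: "real \<Rightarrow> real \<Rightarrow> ennreal" where
  "rpow s t = inverse (ennreal (t powr s))"

lemma measurable_rpow [measurable]: "rpow s \<in> borel_measurable borel"
  unfolding rpow_def by measurable

lemma rpow_zero [simp]: "rpow s 0 = top"
  by (simp add: rpow_def)

lemma rpow_pos: "0 < t \<Longrightarrow> rpow s t = ennreal (t powr - s)"
  by (simp add: rpow_def inverse_ennreal powr_minus)

lemma rpow_antimono:
  assumes "0 \<le> s" "0 \<le> x" "x \<le> y"
  shows "rpow s y \<le> rpow s x"
proof (cases "x = 0")
  case False
  then show ?thesis using assms by (simp add: rpow_pos powr_mono2' ennreal_leI)
qed simp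

lemma rpow_mult: "0 \<le> x \<Longrightarrow> 0 \<le> y \<Longrightarrow> rpow s (x * y) = rpow s x * rpow s y"
  unfolding rpow_def by (simp add: powr_mult ennreal_mult' ennreal_inverse_mult)

text \<open>This is where s < 1 enters, as integrability at 0. The window is the set where |t|/2
  \<le> 1; outside it the integrand is at most 1.\<close>

lemma nn_integral_rpow_finite:
  assumes "0 < s" "s < 1"
  shows "(\<integral>\<^sup>+ t. rpow s (\<bar>t\<bar> / 2) * indicator {-2..2} t \<partial>lborel) < top"
proof -
  let ?I = "\<integral>\<^sup>+ t. rpow s (\<bar>t\<bar> / 2) * indicator {0..2} t \<partial>lborel"
  have "?I = (\<integral>\<^sup>+ t. ennreal (2 powr s * t powr - s) * indicator {0..2} t \<partial>lborel)"
  proof (rule nn_integral_cong_AE)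
    show "AE t in lborel. rpow s (\<bar>t\<bar> / 2) * indicator {0..2} t
        = ennreal (2 powr s * t powr - s) * indicator {0..2} (t :: real)"
      using AE_lborel_singleton[of "0::real"]
      by eventually_elim (auto simp: indicator_def rpow_pos powr_divide powr_minus field_simps)
  qed
  also have "\<dots> = ennreal (2 powr s * (2 powr (- s + 1) / (- s + 1)))"
    using assms by (intro nn_integral_has_integral_lebesgue' has_integral_mult_right has_integral_powr_from_0) auto
  finally have fin: "?I < top" by simp
  have refl: "(\<integral>\<^sup>+ t. rpow s (\<bar>t\<bar> / 2) * indicator {-2..0} t \<partial>lborel) = ?I"
    by (subst nn_integral_real_affine[where c = "-1" and t = 0])
       (auto intro!: nn_integral_cong simp: indicator_def)
  have "(\<integral>\<^sup>+ t. rpow s (\<bar>t\<bar> / 2) * indicator {-2..2} t \<partial>lborel)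
      \<le> (\<integral>\<^sup>+ t. rpow s (\<bar>t\<bar> / 2) * indicator {-2..0} t + rpow s (\<bar>t\<bar> / 2) * indicator {0..2} t \<partial>lborel)"
    by (intro nn_integral_mono) (auto simp: indicator_def)
  also have "\<dots> = ?I + ?I"
    by (subst nn_integral_add) (auto simp: refl)
  also have "\<dots> < top" using fin by simp
  finally show ?thesis .
qed

lemma circle_integral:
  assumes [measurable]: "f \<in> borel_measurable borel"
  shows "(\<integral>\<^sup>+ w. f w \<partial>circle_measure)
    = (\<integral>\<^sup>+ t. f (cis t) * indicator {0..2*pi} t \<partial>lborel) / ennreal (2 * pi)"
  unfolding circle_measure_def
  by (subst nn_integral_distr, simp_all, subst nn_integral_uniform_measure)
     (auto intro!: borel_measurable_continuous_onI continuous_intros measurable_compose[OF _ assms])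

text \<open>Each of the five candidate singularities costs at most \<open>?D\<close>: the length of
  the circle where the integrand is at most 1, plus the translated local integral
  \<open>?J\<close>.\<close>

lemma circle_rpow_bounded:
  assumes s: "0 < s" "s < 1"
  shows "\<exists>K\<ge>1. \<forall>a. (\<integral>\<^sup>+ w. rpow s (norm (w - a)) \<partial>circle_measure) \<le> ennreal K"
proof -
  let ?J = "\<integral>\<^sup>+ t. rpow s (\<bar>t\<bar> / 2) * indicator {-2..2} t \<partial>lborel"
  let ?D = "ennreal (2 * pi) + ?J"
  have one: "(\<integral>\<^sup>+ t. rpow s (\<bar>t - c\<bar> / 2) * indicator {0..2*pi} t \<partial>lborel) \<le> ?D" for c :: real
  proof -
    have "(\<integral>\<^sup>+ t. rpow s (\<bar>t - c\<bar> / 2) * indicator {0..2*pi} t \<partial>lborel)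
      \<le> (\<integral>\<^sup>+ t. indicator {0..2*pi} t + rpow s (\<bar>t - c\<bar> / 2) * indicator {-2..2} (t - c) \<partial>lborel)"
    proof (rule nn_integral_mono)
      fix t :: real
      have "rpow s (\<bar>t - c\<bar> / 2) \<le> rpow s 1" if "t - c \<notin> {-2..2}"
        using that s by (intro rpow_antimono) auto
      then show "rpow s (\<bar>t - c\<bar> / 2) * indicator {0..2*pi} t
          \<le> indicator {0..2*pi} t + rpow s (\<bar>t - c\<bar> / 2) * indicator {-2..2} (t - c)"
        by (auto simp: indicator_def rpow_pos)
    qed
    also have "\<dots> = ennreal (2 * pi) + (\<integral>\<^sup>+ t. rpow s (\<bar>t - c\<bar> / 2) * indicator {-2..2} (t - c) \<partial>lborel)"
      by (subst nn_integral_add) auto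
    also have "(\<integral>\<^sup>+ t. rpow s (\<bar>t - c\<bar> / 2) * indicator {-2..2} (t - c) \<partial>lborel) = ?J"
      by (subst nn_integral_real_affine[where c = 1 and t = c]) auto
    finally show ?thesis .
  qed
  have fin: "?D < top" using nn_integral_rpow_finite[OF s] by simp
  have bound: "(\<integral>\<^sup>+ w. rpow s (norm (w - a)) \<partial>circle_measure) \<le> 5 * ?D / ennreal (2 * pi)" for a
  proof -
    have "(\<integral>\<^sup>+ t. rpow s (norm (cis t - a)) * indicator {0..2*pi} t \<partial>lborel)
       \<le> (\<integral>\<^sup>+ t. (\<Sum>k\<in>{-1..3::int}. rpow s (\<bar>t - (Arg a + of_int k * pi)\<bar> / 2) * indicator {0..2*pi} t) \<partial>lborel)"
    proof (rule nn_integral_mono)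
      fix t :: real
      show "rpow s (norm (cis t - a)) * indicator {0..2*pi} t
        \<le> (\<Sum>k\<in>{-1..3::int}. rpow s (\<bar>t - (Arg a + of_int k * pi)\<bar> / 2) * indicator {0..2*pi} t)"
      proof (cases "t \<in> {0..2*pi}")
        case True
        then obtain k :: int where k: "k \<in> {-1..3}" "\<bar>t - (Arg a + of_int k * pi)\<bar> / 2 \<le> norm (cis t - a)"
          using cis_dist_lower_bound[of t a] by auto
        have "rpow s (norm (cis t - a)) \<le> rpow s (\<bar>t - (Arg a + of_int k * pi)\<bar> / 2)"
          using s k(2) by (intro rpow_antimono) auto
        also have "\<dots> \<le> (\<Sum>k\<in>{-1..3::int}. rpow s (\<bar>t - (Arg a + of_int k * pi)\<bar> / 2))"
          using k(1) by (intro member_le_sum) auto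
        finally show ?thesis using True by simp
      qed simp
    qed
    also have "\<dots> = (\<Sum>k\<in>{-1..3::int}. \<integral>\<^sup>+ t. rpow s (\<bar>t - (Arg a + of_int k * pi)\<bar> / 2) * indicator {0..2*pi} t \<partial>lborel)"
      by (subst nn_integral_sum) auto
    also have "\<dots> \<le> (\<Sum>k\<in>{-1..3::int}. ?D)" by (intro sum_mono one)
    also have "\<dots> = 5 * ?D" by simp
    finally show ?thesis
      by (subst circle_integral) (auto intro!: divide_right_mono_ennreal)
  qed
  obtain d where d: "d \<ge> 0" "?D = ennreal d"
    using fin by (metis ennreal_cases less_top)
  define r where "r = 5 * d / (2 * pi)"
  have "5 * ennreal d = ennreal (5 * d)" using d(1) by (simp add: ennreal_mult)
  then have r: "5 * ?D / ennreal (2 * pi) = ennreal r"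
    unfolding d(2) r_def using d(1) by (simp add: divide_ennreal)
  show ?thesis
  proof (intro exI[of _ "max 1 r"] conjI allI)
    fix a
    show "(\<integral>\<^sup>+ w. rpow s (norm (w - a)) \<partial>circle_measure) \<le> ennreal (max 1 r)"
      using bound[of a] unfolding r by (rule order_trans) (simp add: ennreal_leI)
  qed simp
qed

text \<open>Factoring out \<open>b\<close> gives the first bound. On the unit circle |a + b w| =
  |cnj b + cnj a * w|, which exchanges the coefficients and gives the second. A vanishing
  coefficient makes the right-hand side infinite.\<close>

lemma circle_rpow_affine:
  assumes K: "K \<ge> 1" "\<And>a. (\<integral>\<^sup>+ w. rpow s (norm (w - a)) \<partial>circle_measure) \<le> ennreal K"
  shows "(\<integral>\<^sup>+ w. rpow s (norm (a + b * w)) \<partial>circle_measure) \<le> ennreal K * rpow s (norm b)"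
    and "(\<integral>\<^sup>+ w. rpow s (norm (a + b * w)) \<partial>circle_measure) \<le> ennreal K * rpow s (norm a)"
proof -
  have 1: "(\<integral>\<^sup>+ w. rpow s (norm (a + b * w)) \<partial>circle_measure) \<le> ennreal K * rpow s (norm b)" for a b
  proof (cases "b = 0")
    case True
    then show ?thesis using K(1) by (simp add: ennreal_mult_top)
  next
    case False
    have "a + b * w = b * (w - (- a / b))" for w
      using False by (simp add: algebra_simps)
    then have "norm (a + b * w) = norm b * norm (w - (- a / b))" for w
      by (metis norm_mult)
    then have "(\<integral>\<^sup>+ w. rpow s (norm (a + b * w)) \<partial>circle_measure)
        = (\<integral>\<^sup>+ w. rpow s (norm b) * rpow s (norm (w - (- a / b))) \<partial>circle_measure)"
      by (simp add: rpow_mult)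
    also have "\<dots> = rpow s (norm b) * (\<integral>\<^sup>+ w. rpow s (norm (w - (- a / b))) \<partial>circle_measure)"
      by (rule nn_integral_cmult) measurable
    also have "\<dots> \<le> rpow s (norm b) * ennreal K" by (intro mult_left_mono K(2)) auto
    finally show ?thesis by (simp add: mult.commute)
  qed
  show "(\<integral>\<^sup>+ w. rpow s (norm (a + b * w)) \<partial>circle_measure) \<le> ennreal K * rpow s (norm b)"
    by (rule 1)
  have swap: "norm (a + b * w) = norm (cnj b + cnj a * w)" if "norm w = 1" for w
  proof -
    have "w * cnj w = 1" using that by (simp add: complex_norm_square[symmetric])
    then have "cnj b + cnj a * w = w * cnj (a + b * w)"
      by (simp add: algebra_simps)
    then show ?thesis using that by (simp only: norm_mult complex_mod_cnj mult_1)
  qed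
  have "(\<integral>\<^sup>+ w. rpow s (norm (a + b * w)) \<partial>circle_measure)
      = (\<integral>\<^sup>+ w. rpow s (norm (cnj b + cnj a * w)) \<partial>circle_measure)"
    using AE_circle_norm by (intro nn_integral_cong_AE) (auto simp: swap)
  also have "\<dots> \<le> ennreal K * rpow s (norm a)" using 1[of "cnj b" "cnj a"] by simp
  finally show "(\<integral>\<^sup>+ w. rpow s (norm (a + b * w)) \<partial>circle_measure) \<le> ennreal K * rpow s (norm a)" .
qed

section \<open>A priori bounds from two phases\<close>

lemma unimod_fun_upd: "unimod \<omega> \<Longrightarrow> norm w = 1 \<Longrightarrow> unimod (fun_upd \<omega> x w)"
  by (simp add: unimod_def)

text \<open>\<open>flux\<close> through the source site alone, where \<open>hop\<close> of the
  column takes the value 1 + z D. The two sides are the numerator and the slope of the quotient in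
  \<open>green_diag_phase\<close>.\<close>

lemma green_diag_bounds:
  fixes \<nu> :: site
  assumes "unimod \<omega>" "paired \<theta>" "norm z \<noteq> 1"
  defines "D \<equiv> green \<theta> \<omega> z \<nu> \<nu>"
  shows "norm z > 1 \<Longrightarrow> norm (1 + z * D) \<le> norm D"
    and "norm z < 1 \<Longrightarrow> norm D \<le> norm (1 + z * D)"
proof -
  let ?G = "green \<theta> \<omega> z \<nu>"
  have l2: "in_l2 ?G" and eq: "hop \<theta> \<omega> ?G y = unit_at \<nu> y + z * ?G y" for y
    using solves_green[OF assms(1-3)] by (auto simp: solves_def algebra_simps)
  have off: "hop \<theta> \<omega> ?G y = z * ?G y" if "y \<notin> {\<nu>}" for y
    using that by (simp add: eq unit_at_def)
  show "norm z > 1 \<Longrightarrow> norm (1 + z * D) \<le> norm D"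
    using flux(1)[OF assms(1,2) l2 _ off, of "{\<nu>}"]
    by (simp add: eq unit_at_def D_def power_mono_iff)
  show "norm z < 1 \<Longrightarrow> norm D \<le> norm (1 + z * D)"
    using flux(2)[OF assms(1,2) l2 _ off, of "{\<nu>}"]
    by (simp add: eq unit_at_def D_def power_mono_iff)
qed

text \<open>A zero would force |1 + z D| = |z| |D|. Together with \<open>green_diag_bounds\<close>
  this gives D = 0, and then the expression is \<open>w\<close>.\<close>

lemma green_diag_nonzero:
  fixes \<nu> :: site
  assumes "unimod \<omega>" "paired \<theta>" "norm z \<noteq> 1" "norm w = 1"
  defines "D \<equiv> green \<theta> \<omega> z \<nu> \<nu>"
  shows "(1 + z * D) * w - z * D \<noteq> 0"
proof
  assume 0: "(1 + z * D) * w - z * D = 0"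
  then have "norm (1 + z * D) * norm w = norm (z * D)" by (simp flip: norm_mult)
  then have n: "norm (1 + z * D) = norm z * norm D" using assms(4) by (simp add: norm_mult)
  have "D = 0"
  proof (cases "norm z > 1")
    case True
    then have "norm z * norm D \<le> 1 * norm D"
      using green_diag_bounds(1)[OF assms(1-3), of \<nu>] by (simp add: D_def[symmetric] n)
    then show ?thesis using True by (meson mult_le_cancel_right norm_le_zero_iff not_le)
  next
    case False
    then have "norm z < 1" using assms(3) by simp
    then have "1 * norm D \<le> norm z * norm D"
      using green_diag_bounds(2)[OF assms(1-3), of \<nu>] by (simp add: D_def[symmetric] n)
    then show ?thesis using \<open>norm z < 1\<close> by (meson mult_le_cancel_right norm_le_zero_iff not_le)
  qed
  then show False using 0 assms(4) by auto
qed

text \<open>A rank-one perturbation: the new column solves the old equation with a multiple \<beta>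
  of the same source, hence is \<beta> times the old column, and the equation at \<nu> determines
  \<beta>. Normalizing the old phase to 1 makes \<open>w\<close> the new phase itself.\<close>

lemma green_diag_phase:
  assumes "unimod \<omega>" "paired \<theta>" "norm z \<noteq> 1" "norm w = 1" "\<omega> \<nu> = 1"
  defines "D \<equiv> green \<theta> \<omega> z \<nu> \<nu>"
  shows "green \<theta> (fun_upd \<omega> \<nu> w) z \<nu> \<nu> * ((1 + z * D) * w - z * D) = D"
proof -
  define \<psi> where "\<psi> = green \<theta> (fun_upd \<omega> \<nu> w) z \<nu>"
  have sol: "in_l2 \<psi>" "hop \<theta> (fun_upd \<omega> \<nu> w) \<psi> y - z * \<psi> y = unit_at \<nu> y" for y
    using solves_green[OF unimod_fun_upd[OF assms(1,4)] assms(2,3)] by (auto simp: \<psi>_def solves_def)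
  define \<beta> where "\<beta> = hop \<theta> \<omega> \<psi> \<nu> - z * \<psi> \<nu>"
  have "hop \<theta> \<omega> \<psi> y - z * \<psi> y = \<beta> * unit_at \<nu> y" for y
    using sol(2)[of y] by (cases "y = \<nu>") (auto simp: \<beta>_def unit_at_def hop_def)
  then have "solves \<theta> \<omega> z (\<lambda>y. \<beta> * unit_at \<nu> y) \<psi>"
    using sol(1) by (simp add: solves_def)
  then have "\<psi> = (\<lambda>y. \<beta> * green \<theta> \<omega> z \<nu> y)"
    using solves_unique[OF assms(1-3) _ solves_cmult[OF solves_green[OF assms(1-3)]]] by blast
  then have q: "\<psi> \<nu> = \<beta> * D" by (simp add: D_def)
  have "w * hop \<theta> \<omega> \<psi> \<nu> - z * \<psi> \<nu> = 1"
    using sol(2)[of \<nu>] by (simp add: hop_def unit_at_def assms(5) algebra_simps)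
  then have "\<beta> * w = z * \<psi> \<nu> + 1 - z * \<psi> \<nu> * w"
    by (simp add: \<beta>_def algebra_simps)
  with q have "\<psi> \<nu> * ((1 + z * D) * w - z * D) = D" by algebra
  then show ?thesis by (simp add: \<psi>_def)
qed

text \<open>For the 2x2 block G of the Green function on \<open>x\<close> and \<nu>,
  \<open>flux\<close> compares the norms of (1 + z G) u and G u for every vector u = (a, b).\<close>

lemma two_site_flux:
  assumes "unimod \<omega>" "paired \<theta>" "norm z \<noteq> 1" "x \<noteq> \<nu>"
  defines "A \<equiv> green \<theta> \<omega> z x x" and "B \<equiv> green \<theta> \<omega> z \<nu> x"
    and "C \<equiv> green \<theta> \<omega> z x \<nu>" and "D \<equiv> green \<theta> \<omega> z \<nu> \<nu>"
  shows "norm z > 1 \<Longrightarrow> (norm (z * (a * A + b * B) + a))\<^sup>2 + (norm (z * (a * C + b * D) + b))\<^sup>2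
           \<le> (norm (a * A + b * B))\<^sup>2 + (norm (a * C + b * D))\<^sup>2"
    and "norm z < 1 \<Longrightarrow> (norm (a * A + b * B))\<^sup>2 + (norm (a * C + b * D))\<^sup>2
           \<le> (norm (z * (a * A + b * B) + a))\<^sup>2 + (norm (z * (a * C + b * D) + b))\<^sup>2"
proof -
  let ?\<psi> = "\<lambda>y. a * green \<theta> \<omega> z x y + b * green \<theta> \<omega> z \<nu> y"
  have "solves \<theta> \<omega> z (\<lambda>y. a * unit_at x y + b * unit_at \<nu> y) ?\<psi>"
    by (intro solves_add solves_cmult solves_green assms)
  then have l2: "in_l2 ?\<psi>"
    and eq: "hop \<theta> \<omega> ?\<psi> y = z * ?\<psi> y + (a * unit_at x y + b * unit_at \<nu> y)" for y
    by (simp_all add: solves_def diff_eq_eq add.commute)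
  have off: "hop \<theta> \<omega> ?\<psi> y = z * ?\<psi> y" if "y \<notin> {x, \<nu>}" for y
    using that by (simp add: eq unit_at_def)
  have at: "hop \<theta> \<omega> ?\<psi> x = z * (a * A + b * B) + a" "hop \<theta> \<omega> ?\<psi> \<nu> = z * (a * C + b * D) + b"
    using assms(4) by (simp_all add: eq unit_at_def A_def B_def C_def D_def)
  show "norm z > 1 \<Longrightarrow> (norm (z * (a * A + b * B) + a))\<^sup>2 + (norm (z * (a * C + b * D) + b))\<^sup>2
           \<le> (norm (a * A + b * B))\<^sup>2 + (norm (a * C + b * D))\<^sup>2"
    using flux(1)[OF assms(1,2) l2 _ off, of "{x, \<nu>}"] assms(4) at
    by (simp add: A_def B_def C_def D_def)
  show "norm z < 1 \<Longrightarrow> (norm (a * A + b * B))\<^sup>2 + (norm (a * C + b * D))\<^sup>2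
           \<le> (norm (z * (a * A + b * B) + a))\<^sup>2 + (norm (z * (a * C + b * D) + b))\<^sup>2"
    using flux(2)[OF assms(1,2) l2 _ off, of "{x, \<nu>}"] assms(4) at
    by (simp add: A_def B_def C_def D_def)
qed

text \<open>The vector u is chosen to annihilate one component on the larger side. For |z| > 1, u =
  (B, -A) gives G u = (0, -det G); for |z| < 1, u = (z B, -(1 + z A)) gives (1 + z G) u = (0, -det
  (1 + z G)). In both cases B or -B is a component of the smaller side.\<close>

lemma two_site_bounds:
  assumes "unimod \<omega>" "paired \<theta>" "norm z \<noteq> 1" "x \<noteq> \<nu>"
  defines "A \<equiv> green \<theta> \<omega> z x x" and "B \<equiv> green \<theta> \<omega> z \<nu> x"
    and "C \<equiv> green \<theta> \<omega> z x \<nu>" and "D \<equiv> green \<theta> \<omega> z \<nu> \<nu>"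
  shows "norm z > 1 \<Longrightarrow> norm B \<le> norm (A * D - B * C)"
    and "norm z < 1 \<Longrightarrow> norm B \<le> norm ((1 + z * A) * (1 + z * D) - z\<^sup>2 * B * C)"
proof -
  note fl = two_site_flux[OF assms(1-4), folded A_def B_def C_def D_def]
  show "norm B \<le> norm (A * D - B * C)" if "norm z > 1"
  proof (rule power2_le_imp_le)
    have e: "B * A + - A * B = 0" "B * C + - A * D = - (A * D - B * C)" by (simp_all add: algebra_simps)
    have "(norm B)\<^sup>2 \<le> (norm (z * (B * A + - A * B) + B))\<^sup>2 + (norm (z * (B * C + - A * D) + - A))\<^sup>2"
      unfolding e(1) by simp
    also have "\<dots> \<le> (norm (A * D - B * C))\<^sup>2"
      using fl(1)[OF that, of B "- A"] unfolding e norm_minus_cancel by simp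
    finally show "(norm B)\<^sup>2 \<le> (norm (A * D - B * C))\<^sup>2" .
  qed simp
  show "norm B \<le> norm ((1 + z * A) * (1 + z * D) - z\<^sup>2 * B * C)" if "norm z < 1"
  proof (rule power2_le_imp_le)
    let ?a = "z * B" and ?b = "- (1 + z * A)"
    have e: "?a * A + ?b * B = - B" "z * (- B) + ?a = 0"
      "z * (?a * C + ?b * D) + ?b = - ((1 + z * A) * (1 + z * D) - z\<^sup>2 * B * C)"
      by (simp_all add: algebra_simps power2_eq_square)
    have "(norm B)\<^sup>2 \<le> (norm (?a * A + ?b * B))\<^sup>2 + (norm (?a * C + ?b * D))\<^sup>2"
      unfolding e by simp
    also have "\<dots> \<le> (norm ((1 + z * A) * (1 + z * D) - z\<^sup>2 * B * C))\<^sup>2"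
      using fl(2)[OF that, of ?a ?b] unfolding e norm_minus_cancel by simp
    finally show "(norm B)\<^sup>2 \<le> (norm ((1 + z * A) * (1 + z * D) - z\<^sup>2 * B * C))\<^sup>2" .
  qed simp
qed

text \<open>Changing the phases at \<open>x\<close> and \<open>\<nu>\<close> is a rank-two perturbation, so the new entry is a quotient
  whose denominator is affine in each phase separately. Its constant and its \<open>v * w\<close> coefficient
  are the quantities that dominate \<open>B\<close> in \<open>two_site_bounds\<close>.\<close>

lemma two_site_phase:
  assumes "unimod \<omega>" "paired \<theta>" "norm z \<noteq> 1" "norm v = 1" "norm w = 1"
    and "\<omega> x = 1" "\<omega> \<nu> = 1" "x \<noteq> \<nu>"
  defines "A \<equiv> green \<theta> \<omega> z x x" and "B \<equiv> green \<theta> \<omega> z \<nu> x"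
    and "C \<equiv> green \<theta> \<omega> z x \<nu>" and "D \<equiv> green \<theta> \<omega> z \<nu> \<nu>"
  defines "p \<equiv> green \<theta> (fun_upd (fun_upd \<omega> x v) \<nu> w) z \<nu> x"
  shows "p * (((1 + z * A) * v - z * A) * ((1 + z * D) * w - z * D) - z\<^sup>2 * B * C * (1 - v) * (1 - w)) = B * v"
    and "B = 0 \<Longrightarrow> p = 0"
proof -
  let ?\<omega> = "fun_upd (fun_upd \<omega> x v) \<nu> w"
  define \<psi> where "\<psi> = green \<theta> ?\<omega> z \<nu>"
  have un: "unimod ?\<omega>" by (intro unimod_fun_upd assms)
  have sol: "in_l2 \<psi>" "hop \<theta> ?\<omega> \<psi> y - z * \<psi> y = unit_at \<nu> y" for y
    using solves_green[OF un assms(2,3)] by (auto simp: \<psi>_def solves_def)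
  define \<alpha> \<beta> where "\<alpha> = hop \<theta> \<omega> \<psi> x - z * \<psi> x" and "\<beta> = hop \<theta> \<omega> \<psi> \<nu> - z * \<psi> \<nu>"
  have "hop \<theta> \<omega> \<psi> y - z * \<psi> y = \<alpha> * unit_at x y + \<beta> * unit_at \<nu> y" for y
    using sol(2)[of y] assms(8)
    by (cases "y = \<nu>"; cases "y = x") (auto simp: \<alpha>_def \<beta>_def unit_at_def hop_def)
  then have "solves \<theta> \<omega> z (\<lambda>y. \<alpha> * unit_at x y + \<beta> * unit_at \<nu> y) \<psi>"
    using sol(1) by (simp add: solves_def)
  moreover have "solves \<theta> \<omega> z (\<lambda>y. \<alpha> * unit_at x y + \<beta> * unit_at \<nu> y)
      (\<lambda>y. \<alpha> * green \<theta> \<omega> z x y + \<beta> * green \<theta> \<omega> z \<nu> y)"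
    by (intro solves_add solves_cmult solves_green assms)
  ultimately have \<psi>: "\<psi> = (\<lambda>y. \<alpha> * green \<theta> \<omega> z x y + \<beta> * green \<theta> \<omega> z \<nu> y)"
    by (rule solves_unique[OF assms(1-3)])
  have p: "p = \<alpha> * A + \<beta> * B" and q: "\<psi> \<nu> = \<alpha> * C + \<beta> * D"
    unfolding p_def \<psi>_def[symmetric] by (subst \<psi>, simp add: A_def B_def C_def D_def)+
  have px: "p = \<psi> x" by (simp add: p_def \<psi>_def)
  have "v * hop \<theta> \<omega> \<psi> x - z * p = 0"
    using sol(2)[of x] assms(8) by (simp add: hop_def unit_at_def assms(6) px algebra_simps)
  then have \<alpha>: "\<alpha> * v = z * p * (1 - v)" by (simp add: \<alpha>_def px algebra_simps)
  have "w * hop \<theta> \<omega> \<psi> \<nu> - z * \<psi> \<nu> = 1"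
    using sol(2)[of \<nu>] by (simp add: hop_def unit_at_def assms(7) algebra_simps)
  then have \<beta>: "\<beta> * w = z * \<psi> \<nu> + 1 - z * \<psi> \<nu> * w" by (simp add: \<beta>_def algebra_simps)
  have nz: "v \<noteq> 0" "w \<noteq> 0" using assms(4,5) by auto
  have 1: "p * ((1 + z * A) * v - z * A) = B * \<beta> * v" using p \<alpha> by algebra
  have "\<beta> * ((1 + z * D) * w - z * D) = 1 + z * \<alpha> * C * (1 - w)" using q \<beta> by algebra
  then have 2: "\<beta> * v * ((1 + z * D) * w - z * D) = v + z\<^sup>2 * p * (1 - v) * C * (1 - w)"
    using \<alpha> by algebra
  show "p * (((1 + z * A) * v - z * A) * ((1 + z * D) * w - z * D) - z\<^sup>2 * B * C * (1 - v) * (1 - w)) = B * v"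
    using 1 2 by algebra
  \<comment> \<open>For B = 0 the product identity alone would allow p to be anything at a zero of
    the denominator; the intermediate identity \<open>1\<close> has a factor that cannot vanish on
    the circle.\<close>
  show "p = 0" if "B = 0"
    using 1 that green_diag_nonzero[OF assms(1-4), of x] by (simp add: A_def)
qed

lemma powr_rpow_le_1:
  assumes "0 < s" "0 \<le> u" "u \<le> t"
  shows "ennreal (u powr s) * rpow s t \<le> 1"
proof (cases "u = 0")
  case False
  then have t: "0 < t" using assms by simp
  have "u powr s * t powr - s \<le> t powr s * t powr - s"
    using assms by (intro mult_right_mono powr_mono2) auto
  also have "\<dots> = 1" using t by (simp flip: powr_add)
  finally show ?thesis using t by (simp add: rpow_pos flip: ennreal_mult')
qed simp

text \<open>Each integration may retain either coefficient of an affine function. Retaining the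
  constant one twice leaves \<open>a\<close>, retaining the slope twice leaves
  \<open>d\<close>.\<close>

lemma nn_integral_rpow_bilinear:
  assumes K: "K \<ge> 1" "\<And>a. (\<integral>\<^sup>+ w. rpow s (norm (w - a)) \<partial>circle_measure) \<le> ennreal K"
  shows "(\<integral>\<^sup>+ w. \<integral>\<^sup>+ v. rpow s (norm ((a + b * w) + (c + d * w) * v)) \<partial>circle_measure \<partial>circle_measure)
      \<le> ennreal K * (ennreal K * rpow s (norm a))"
    and "(\<integral>\<^sup>+ w. \<integral>\<^sup>+ v. rpow s (norm ((a + b * w) + (c + d * w) * v)) \<partial>circle_measure \<partial>circle_measure)
      \<le> ennreal K * (ennreal K * rpow s (norm d))"
proof -
  note aff = circle_rpow_affine[OF K]
  have "(\<integral>\<^sup>+ w. \<integral>\<^sup>+ v. rpow s (norm ((a + b * w) + (c + d * w) * v)) \<partial>circle_measure \<partial>circle_measure)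
      \<le> (\<integral>\<^sup>+ w. ennreal K * rpow s (norm (a + b * w)) \<partial>circle_measure)"
    by (intro nn_integral_mono aff)
  also have "\<dots> \<le> ennreal K * (ennreal K * rpow s (norm a))"
    by (subst nn_integral_cmult) (auto intro!: mult_left_mono aff)
  finally show "(\<integral>\<^sup>+ w. \<integral>\<^sup>+ v. rpow s (norm ((a + b * w) + (c + d * w) * v)) \<partial>circle_measure \<partial>circle_measure)
      \<le> ennreal K * (ennreal K * rpow s (norm a))" .
  have "(\<integral>\<^sup>+ w. \<integral>\<^sup>+ v. rpow s (norm ((a + b * w) + (c + d * w) * v)) \<partial>circle_measure \<partial>circle_measure)
      \<le> (\<integral>\<^sup>+ w. ennreal K * rpow s (norm (c + d * w)) \<partial>circle_measure)"
    by (intro nn_integral_mono aff)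
  also have "\<dots> \<le> ennreal K * (ennreal K * rpow s (norm d))"
    by (subst nn_integral_cmult) (auto intro!: mult_left_mono aff)
  finally show "(\<integral>\<^sup>+ w. \<integral>\<^sup>+ v. rpow s (norm ((a + b * w) + (c + d * w) * v)) \<partial>circle_measure \<partial>circle_measure)
      \<le> ennreal K * (ennreal K * rpow s (norm d))" .
qed

text \<open>The factor \<open>max 1 (norm z)\<close> makes the bounds uniform in \<open>z\<close>, because the recursion below
  involves \<open>z\<close> times the Green function.\<close>

definition moment :: "real \<Rightarrow> (site \<Rightarrow> real) \<Rightarrow> complex \<Rightarrow> site \<Rightarrow> site \<Rightarrow> wave \<Rightarrow> ennreal" where
  "moment s \<theta> z \<nu> \<mu> \<omega> = ennreal ((max 1 (norm z) * norm (green \<theta> \<omega> z \<nu> \<mu>)) powr s)"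

text \<open>Passes from a product identity to a quotient without dividing by zero: for b \<noteq> 0
  the identity itself forces t > 0, and b = 0 is left to the last hypothesis.\<close>

lemma moment_le_rpow:
  assumes "0 < s" "norm (green \<theta> \<omega> z \<nu> \<mu>) * t = b" "0 \<le> t" "b = 0 \<Longrightarrow> green \<theta> \<omega> z \<nu> \<mu> = 0"
  shows "moment s \<theta> z \<nu> \<mu> \<omega> \<le> ennreal ((max 1 (norm z) * b) powr s) * rpow s t"
proof (cases "b = 0")
  case True
  then show ?thesis using assms by (simp add: moment_def)
next
  case False
  then have t: "0 < t" using assms by (cases "t = 0") auto
  then have g: "norm (green \<theta> \<omega> z \<nu> \<mu>) = b / t" and b: "b \<ge> 0" using assms(2) by (auto simp: field_simps)
  have "ennreal ((max 1 (norm z) * b) powr s) * rpow s t = ennreal ((max 1 (norm z) * b) powr s * t powr - s)"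
    using t by (simp add: rpow_pos ennreal_mult)
  also have "(max 1 (norm z) * b) powr s * t powr - s = (max 1 (norm z) * b / t) powr s"
    using t b by (simp add: powr_divide powr_minus_divide)
  finally show ?thesis by (simp add: moment_def g)
qed

text \<open>For |z| > 1 the weighted numerator equals the modulus of the constant coefficient -z D;
  for |z| < 1 it is dominated by the slope 1 + z D. That coefficient is the one retained.\<close>

lemma apriori_diag:
  assumes "0 < s" and K: "K \<ge> 1" "\<And>a. (\<integral>\<^sup>+ w. rpow s (norm (w - a)) \<partial>circle_measure) \<le> ennreal K"
    and "unimod \<omega>" "paired \<theta>" "norm z \<noteq> 1"
  shows "(\<integral>\<^sup>+ w. moment s \<theta> z \<nu> \<nu> (fun_upd \<omega> \<nu> w) \<partial>circle_measure) \<le> ennreal K"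
proof -
  define \<omega>1 where "\<omega>1 = fun_upd \<omega> \<nu> 1"
  have un: "unimod \<omega>1" using assms(4) by (simp add: \<omega>1_def unimod_fun_upd)
  define D where "D = green \<theta> \<omega>1 z \<nu> \<nu>"
  let ?m = "max 1 (norm z)"
  let ?c = "ennreal ((?m * norm D) powr s)"
  have "moment s \<theta> z \<nu> \<nu> (fun_upd \<omega> \<nu> w) \<le> ?c * rpow s (norm (- (z * D) + (1 + z * D) * w))"
    if "norm w = 1" for w
  proof (rule moment_le_rpow)
    have e: "green \<theta> (fun_upd \<omega> \<nu> w) z \<nu> \<nu> * ((1 + z * D) * w - z * D) = D"
      using green_diag_phase[OF un assms(5,6) that, of \<nu>] by (simp add: \<omega>1_def D_def)
    have e': "- (z * D) + (1 + z * D) * w = (1 + z * D) * w - z * D" by simp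
    show "norm (green \<theta> (fun_upd \<omega> \<nu> w) z \<nu> \<nu>) * norm (- (z * D) + (1 + z * D) * w) = norm D"
      unfolding e' norm_mult[symmetric] e ..
    show "green \<theta> (fun_upd \<omega> \<nu> w) z \<nu> \<nu> = 0" if "norm D = 0"
      using e green_diag_nonzero[OF un assms(5,6) \<open>norm w = 1\<close>, of \<nu>] that by (simp add: D_def)
  qed (use assms in auto)
  then have "(\<integral>\<^sup>+ w. moment s \<theta> z \<nu> \<nu> (fun_upd \<omega> \<nu> w) \<partial>circle_measure)
      \<le> (\<integral>\<^sup>+ w. ?c * rpow s (norm (- (z * D) + (1 + z * D) * w)) \<partial>circle_measure)"
    using AE_circle_norm by (intro nn_integral_mono_AE) auto
  also have "\<dots> = ?c * (\<integral>\<^sup>+ w. rpow s (norm (- (z * D) + (1 + z * D) * w)) \<partial>circle_measure)"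
    by (rule nn_integral_cmult) measurable
  also have "\<dots> \<le> ennreal K"
  proof (cases "norm z > 1")
    case True
    have "?c * (\<integral>\<^sup>+ w. rpow s (norm (- (z * D) + (1 + z * D) * w)) \<partial>circle_measure)
        \<le> ?c * (ennreal K * rpow s (norm (- (z * D))))"
      by (intro mult_left_mono circle_rpow_affine(2)[OF K]) auto
    also have "\<dots> = ennreal K * (?c * rpow s (norm (- (z * D))))" by (simp add: mult_ac)
    also have "\<dots> \<le> ennreal K * 1"
      using True assms(1) by (intro mult_left_mono powr_rpow_le_1) (auto simp: norm_mult)
    finally show ?thesis by simp
  next
    case False
    then have z: "norm z < 1" using assms(6) by simp
    have "?c * (\<integral>\<^sup>+ w. rpow s (norm (- (z * D) + (1 + z * D) * w)) \<partial>circle_measure)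
        \<le> ?c * (ennreal K * rpow s (norm (1 + z * D)))"
      by (intro mult_left_mono circle_rpow_affine(1)[OF K]) auto
    also have "\<dots> = ennreal K * (?c * rpow s (norm (1 + z * D)))" by (simp add: mult_ac)
    also have "\<dots> \<le> ennreal K * 1"
      using z assms(1) green_diag_bounds(2)[OF un assms(5,6) z]
      by (intro mult_left_mono powr_rpow_le_1) (auto simp: D_def)
    finally show ?thesis by simp
  qed
  finally show ?thesis .
qed

lemma apriori_offdiag:
  assumes "0 < s" and K: "K \<ge> 1" "\<And>a. (\<integral>\<^sup>+ w. rpow s (norm (w - a)) \<partial>circle_measure) \<le> ennreal K"
    and "unimod \<omega>" "paired \<theta>" "norm z \<noteq> 1" "x \<noteq> \<nu>"
  shows "(\<integral>\<^sup>+ w. \<integral>\<^sup>+ v. moment s \<theta> z \<nu> x (fun_upd (fun_upd \<omega> \<nu> w) x v) \<partial>circle_measure \<partial>circle_measure)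
    \<le> ennreal (K * K)"
proof -
  define \<omega>1 where "\<omega>1 = fun_upd (fun_upd \<omega> x 1) \<nu> 1"
  have un: "unimod \<omega>1" using assms(4) by (simp add: \<omega>1_def unimod_fun_upd)
  have one: "\<omega>1 x = 1" "\<omega>1 \<nu> = 1" by (simp_all add: \<omega>1_def)
  have upd: "fun_upd (fun_upd \<omega> \<nu> w) x v = fun_upd (fun_upd \<omega>1 x v) \<nu> w" for v w
    using assms(7) by (auto simp: \<omega>1_def fun_eq_iff)
  define A B C D where "A = green \<theta> \<omega>1 z x x" and "B = green \<theta> \<omega>1 z \<nu> x"
    and "C = green \<theta> \<omega>1 z x \<nu>" and "D = green \<theta> \<omega>1 z \<nu> \<nu>"
  note defs = A_def B_def C_def D_def
  \<comment> \<open>With G the 2x2 block, \<open>?a\<close> is z^2 det G and \<open>?d\<close> is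
    det (1 + z G), the quantities of \<open>two_site_bounds\<close>.\<close>
  let ?a = "z\<^sup>2 * (A * D - B * C)" and ?b = "- z * A * (1 + z * D) + z\<^sup>2 * B * C"
  let ?c = "- z * D * (1 + z * A) + z\<^sup>2 * B * C"
  let ?d = "(1 + z * A) * (1 + z * D) - z\<^sup>2 * B * C"
  let ?\<Delta> = "\<lambda>v w. (?a + ?b * w) + (?c + ?d * w) * v"
  let ?k = "ennreal ((max 1 (norm z) * norm B) powr s)"
  have pt: "moment s \<theta> z \<nu> x (fun_upd (fun_upd \<omega> \<nu> w) x v) \<le> ?k * rpow s (norm (?\<Delta> v w))"
    if "norm w = 1" "norm v = 1" for v w
  proof (rule moment_le_rpow)
    note ph = two_site_phase[OF un assms(5,6) that(2,1) one assms(7), folded defs upd]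
    have \<Delta>: "?\<Delta> v w = ((1 + z * A) * v - z * A) * ((1 + z * D) * w - z * D) - z\<^sup>2 * B * C * (1 - v) * (1 - w)"
      by algebra
    show "norm (green \<theta> (fun_upd (fun_upd \<omega> \<nu> w) x v) z \<nu> x) * norm (?\<Delta> v w) = norm B"
      unfolding \<Delta> norm_mult[symmetric] ph(1) using that by (simp add: norm_mult)
    show "green \<theta> (fun_upd (fun_upd \<omega> \<nu> w) x v) z \<nu> x = 0" if "norm B = 0"
      using ph(2) that by simp
  qed (use assms in auto)
  have "(\<integral>\<^sup>+ w. \<integral>\<^sup>+ v. moment s \<theta> z \<nu> x (fun_upd (fun_upd \<omega> \<nu> w) x v) \<partial>circle_measure \<partial>circle_measure)
      \<le> (\<integral>\<^sup>+ w. \<integral>\<^sup>+ v. ?k * rpow s (norm (?\<Delta> v w)) \<partial>circle_measure \<partial>circle_measure)"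
  proof (rule nn_integral_mono_AE)
    show "AE w in circle_measure. (\<integral>\<^sup>+ v. moment s \<theta> z \<nu> x (fun_upd (fun_upd \<omega> \<nu> w) x v) \<partial>circle_measure)
        \<le> (\<integral>\<^sup>+ v. ?k * rpow s (norm (?\<Delta> v w)) \<partial>circle_measure)"
      using AE_circle_norm
    proof eventually_elim
      case (elim w)
      show ?case
      proof (rule nn_integral_mono_AE)
        show "AE v in circle_measure. moment s \<theta> z \<nu> x (fun_upd (fun_upd \<omega> \<nu> w) x v) \<le> ?k * rpow s (norm (?\<Delta> v w))"
          using AE_circle_norm by eventually_elim (rule pt[OF elim])
      qed
    qed
  qed
  also have "\<dots> = ?k * (\<integral>\<^sup>+ w. \<integral>\<^sup>+ v. rpow s (norm (?\<Delta> v w)) \<partial>circle_measure \<partial>circle_measure)"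
  proof -
    interpret C: prob_space circle_measure by (rule prob_space_circle)
    have "(\<integral>\<^sup>+ v. ?k * rpow s (norm (?\<Delta> v w)) \<partial>circle_measure)
        = ?k * (\<integral>\<^sup>+ v. rpow s (norm (?\<Delta> v w)) \<partial>circle_measure)" for w
      by (rule nn_integral_cmult) measurable
    then show ?thesis
      by (simp only:) (rule nn_integral_cmult, measurable)
  qed
  also have "\<dots> \<le> ennreal (K * K)"
  proof (cases "norm z > 1")
    case True
    have "?k * (\<integral>\<^sup>+ w. \<integral>\<^sup>+ v. rpow s (norm (?\<Delta> v w)) \<partial>circle_measure \<partial>circle_measure)
        \<le> ?k * (ennreal K * (ennreal K * rpow s (norm ?a)))"
      by (intro mult_left_mono nn_integral_rpow_bilinear(1)[OF K]) auto
    also have "\<dots> = ennreal K * (ennreal K * (?k * rpow s (norm ?a)))" by (simp add: mult_ac)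
    also have "\<dots> \<le> ennreal K * (ennreal K * 1)"
    proof (intro mult_left_mono powr_rpow_le_1)
      \<comment> \<open>The factor z^2 in \<open>?a\<close> leaves room for the weight |z|, since
        |z| \<le> |z|^2 here.\<close>
      have "norm z * 1 \<le> norm z * norm z" using True by (intro mult_left_mono) auto
      then have "max 1 (norm z) * norm B \<le> (norm z)\<^sup>2 * norm (A * D - B * C)"
        using True two_site_bounds(1)[OF un assms(5,6,7) True]
        by (intro mult_mono) (auto simp: defs power2_eq_square)
      then show "max 1 (norm z) * norm B \<le> norm ?a" by (simp add: norm_mult norm_power)
    qed (use assms in auto)
    finally show ?thesis using K(1) by (simp add: ennreal_mult)
  next
    case False
    then have z: "norm z < 1" using assms(6) by simp
    have "?k * (\<integral>\<^sup>+ w. \<integral>\<^sup>+ v. rpow s (norm (?\<Delta> v w)) \<partial>circle_measure \<partial>circle_measure)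
        \<le> ?k * (ennreal K * (ennreal K * rpow s (norm ?d)))"
      by (intro mult_left_mono nn_integral_rpow_bilinear(2)[OF K]) auto
    also have "\<dots> = ennreal K * (ennreal K * (?k * rpow s (norm ?d)))" by (simp add: mult_ac)
    also have "\<dots> \<le> ennreal K * (ennreal K * 1)"
      using z assms(1) two_site_bounds(2)[OF un assms(5,6,7) z]
      by (intro mult_left_mono powr_rpow_le_1) (auto simp: defs)
    finally show ?thesis using K(1) by (simp add: ennreal_mult)
  qed
  finally show ?thesis .
qed

section \<open>Decoupling a cell\<close>

text \<open>The label of the counterclockwise plaquette containing the site. \<open>ccw_map\<close>
  preserves it, while \<open>cw_map\<close> always leaves it.\<close>

definition cell :: "site \<Rightarrow> int \<times> int" where
  "cell x = (fst x div 2, snd x div 2)"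

lemma cell_ccw_inv [simp]: "cell (ccw_inv x) = cell x"
  by (cases x) (auto simp: cell_def ccw_inv_def elim!: evenE oddE)

lemma cell_cw_inv: "cell (cw_inv x) = cell (partner x)"
  by (metis cell_ccw_inv ccw_inv_partner)

text \<open>Integer valued, so that division by 5 counts rounds of the iteration; it dominates the
  Euclidean distance.\<close>

definition dist1 :: "site \<Rightarrow> site \<Rightarrow> int" where
  "dist1 x y = \<bar>fst x - fst y\<bar> + \<bar>snd x - snd y\<bar>"

lemma dist1_triangle: "dist1 x z \<le> dist1 x y + dist1 y z"
  by (simp add: dist1_def)

lemma dist1_same_cell: "cell x = cell y \<Longrightarrow> dist1 x y \<le> 2"
  unfolding cell_def dist1_def prod.inject by presburger

lemma dist1_partner: "dist1 x (partner x) \<le> 2"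
  by (cases x) (auto simp: dist1_def partner_def ccw_map_def cw_inv_def)

lemma cell_subset: "{x. cell x = c} \<subseteq> {2 * fst c, 2 * fst c + 1} \<times> {2 * snd c, 2 * snd c + 1}"
proof
  fix x assume "x \<in> {x. cell x = c}"
  then have "fst x div 2 = fst c" "snd x div 2 = snd c" by (auto simp: cell_def)
  then have "fst x = 2 * fst c \<or> fst x = 2 * fst c + 1" "snd x = 2 * snd c \<or> snd x = 2 * snd c + 1"
    by presburger+
  then show "x \<in> {2 * fst c, 2 * fst c + 1} \<times> {2 * snd c, 2 * snd c + 1}"
    by (cases x) auto
qed

lemma finite_cell: "finite {x. cell x = c}"
  using cell_subset by (rule finite_subset) simp

lemma card_cell: "card {x. cell x = c} \<le> 4"
proof -
  have "card {x. cell x = c} \<le> card ({2 * fst c, 2 * fst c + 1} \<times> {2 * snd c, 2 * snd c + 1})"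
    by (rule card_mono[OF _ cell_subset]) simp
  also have "\<dots> = 4" by (simp add: card_cartesian_product)
  finally show ?thesis .
qed

text \<open>The outside sites at which \<open>hop\<close> can read a value from the cell:
  \<open>cw_inv t\<close> lies in the cell of \<open>partner t\<close>.\<close>

definition rim :: "int \<times> int \<Rightarrow> site set" where
  "rim c = {t. cell t \<noteq> c \<and> cell (partner t) = c}"

lemma rim_subset: "rim c \<subseteq> partner ` {x. cell x = c}"
  unfolding rim_def by (metis (mono_tags, lifting) image_eqI mem_Collect_eq partner_partner subsetI)

lemma finite_rim: "finite (rim c)"
  using rim_subset finite_cell by (meson finite_imageI finite_subset)

lemma card_rim: "card (rim c) \<le> 4"
proof -
  have "card (rim c) \<le> card (partner ` {x. cell x = c})"
    by (intro card_mono rim_subset finite_imageI finite_cell)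
  also have "\<dots> \<le> 4"
    using card_image_le[OF finite_cell, of partner c] card_cell[of c] by linarith
  finally show ?thesis .
qed

text \<open>The angle is removed at both members of a pair, which keeps the field paired. At such a
  site \<open>hop\<close> reads only \<open>ccw_inv t\<close>, in the cell of the site
  itself.\<close>

definition decouple :: "int \<times> int \<Rightarrow> (site \<Rightarrow> real) \<Rightarrow> site \<Rightarrow> real" where
  "decouple c \<theta> t = (if cell t = c \<or> cell (partner t) = c then 0 else \<theta> t)"

lemma paired_decouple: "paired \<theta> \<Longrightarrow> paired (decouple c \<theta>)"
  by (auto simp: paired_def decouple_def)

lemma decouple_le: "\<bar>\<theta> t\<bar> \<le> r \<Longrightarrow> \<bar>decouple c \<theta> t\<bar> \<le> r"
  by (auto simp: decouple_def)

text \<open>The hypotheses say that P is constant along every link that \<open>hop\<close> uses. The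
  truncated column then solves the same equation, with any phases off P, and uniqueness
  applies.\<close>

lemma green_restrict:
  assumes "unimod \<omega>" "unimod \<omega>'" "paired \<theta>" "norm z \<noteq> 1"
    and P: "\<And>t. P (ccw_inv t) = P t" "\<And>t. \<theta> t \<noteq> 0 \<Longrightarrow> P (partner t) = P t"
    and "\<And>t. P t \<Longrightarrow> \<omega>' t = \<omega> t" "P \<nu>"
  shows "green \<theta> \<omega>' z \<nu> = (\<lambda>x. if P x then green \<theta> \<omega> z \<nu> x else 0)"
proof -
  let ?\<psi> = "green \<theta> \<omega> z \<nu>"
  let ?\<psi>' = "\<lambda>x. if P x then ?\<psi> x else 0"
  have l2: "in_l2 ?\<psi>" and eq: "hop \<theta> \<omega> ?\<psi> y - z * ?\<psi> y = unit_at \<nu> y" for y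
    using solves_green[OF assms(1,3,4)] by (auto simp: solves_def)
  have cw: "P (cw_inv t) = P t" if "\<theta> t \<noteq> 0" for t
    using P(2)[OF that] P(1)[of "partner t"] by simp
  have "hop \<theta> \<omega>' ?\<psi>' t = (if P t then hop \<theta> \<omega> ?\<psi> t else 0)" for t
    using P(1)[of t] cw[of t] assms(7)[of t] by (cases "\<theta> t = 0") (auto simp: hop_def)
  then have "hop \<theta> \<omega>' ?\<psi>' t - z * ?\<psi>' t = unit_at \<nu> t" for t
    using eq[of t] assms(8) by (auto simp: unit_at_def)
  moreover have "in_l2 ?\<psi>'" using l2 by (rule in_l2_mono) auto
  ultimately show ?thesis
    by (intro green_eqI assms) (simp add: solves_def)
qed

text \<open>Restriction to the complement of the cell. This is the independence that keeps the
  decoupled factor fixed while phases in the cell are averaged.\<close>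

lemma green_decouple_local:
  assumes "unimod \<omega>" "unimod \<omega>'" "paired \<theta>" "norm z \<noteq> 1"
    and "\<And>t. cell t \<noteq> c \<Longrightarrow> \<omega>' t = \<omega> t" "cell \<nu> \<noteq> c" "cell \<mu> \<noteq> c"
  shows "green (decouple c \<theta>) \<omega>' z \<nu> \<mu> = green (decouple c \<theta>) \<omega> z \<nu> \<mu>"
proof -
  have "green (decouple c \<theta>) \<omega>' z \<nu> = (\<lambda>x. if cell x \<noteq> c then green (decouple c \<theta>) \<omega> z \<nu> x else 0)"
    using assms by (intro green_restrict[OF _ _ paired_decouple]) (auto simp: decouple_def split: if_splits)
  then show ?thesis using assms(7) by metis
qed

text \<open>Restriction to the cell itself, which is an invariant block of the decoupled
  operator.\<close>

lemma green_decouple_zero: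
  assumes "unimod \<omega>" "paired \<theta>" "norm z \<noteq> 1" "cell \<nu> = c" "cell \<mu> \<noteq> c"
  shows "green (decouple c \<theta>) \<omega> z \<nu> \<mu> = 0"
proof -
  have "green (decouple c \<theta>) \<omega> z \<nu> = (\<lambda>x. if cell x = c then green (decouple c \<theta>) \<omega> z \<nu> x else 0)"
    using assms by (intro green_restrict[OF _ _ paired_decouple]) (auto simp: decouple_def split: if_splits)
  then show ?thesis using assms(5) by (metis (mono_tags))
qed

text \<open>The decoupled operator minus the original one, evaluated at a site whose angle is set to
  0.\<close>

definition defect :: "(site \<Rightarrow> real) \<Rightarrow> wave \<Rightarrow> wave \<Rightarrow> wave" where
  "defect \<theta> \<omega> \<psi> t = \<omega> t * (complex_of_real (1 - cos (\<theta> t)) * \<psi> (ccw_inv t)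
      - \<i> * complex_of_real (sin (\<theta> t)) * \<psi> (cw_inv t))"

text \<open>Sources inside the decoupled cell are invisible from \<open>\<mu>\<close>, so only the outer partners of the
  cell contribute to the resolvent identity.\<close>

lemma green_expansion:
  assumes "unimod \<omega>" "paired \<theta>" "norm z \<noteq> 1" "cell \<mu> \<noteq> cell \<nu>"
  shows "green \<theta> \<omega> z \<nu> \<mu> = (\<Sum>t\<in>rim (cell \<nu>).
      defect \<theta> \<omega> (green \<theta> \<omega> z \<nu>) t * green (decouple (cell \<nu>) \<theta>) \<omega> z t \<mu>)"
proof -
  define c where "c = cell \<nu>"
  let ?\<theta> = "decouple c \<theta>"
  let ?\<psi> = "green \<theta> \<omega> z \<nu>"
  let ?B = "{x. cell x = c}"
  define W where "W = ?B \<union> rim c"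
  have fin: "finite W" "finite ?B" "finite (rim c)"
    by (simp_all add: W_def finite_cell finite_rim)
  have pd: "paired ?\<theta>" by (rule paired_decouple[OF assms(2)])
  have l2: "in_l2 ?\<psi>" and eq: "hop \<theta> \<omega> ?\<psi> y - z * ?\<psi> y = unit_at \<nu> y" for y
    using solves_green[OF assms(1-3)] by (auto simp: solves_def)
  have "hop ?\<theta> \<omega> ?\<psi> t = hop \<theta> \<omega> ?\<psi> t + (if t \<in> W then defect \<theta> \<omega> ?\<psi> t else 0)" for t
    by (auto simp: hop_def defect_def decouple_def W_def rim_def algebra_simps)
  moreover have "(\<Sum>u\<in>W. defect \<theta> \<omega> ?\<psi> u * unit_at u t) = (if t \<in> W then defect \<theta> \<omega> ?\<psi> t else 0)" for t
  proof -
    have "(\<Sum>u\<in>W. defect \<theta> \<omega> ?\<psi> u * unit_at u t) = (\<Sum>u\<in>W. if t = u then defect \<theta> \<omega> ?\<psi> u else 0)"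
      by (intro sum.cong) (auto simp: unit_at_def)
    then show ?thesis using fin(1) by simp
  qed
  ultimately have "hop ?\<theta> \<omega> ?\<psi> t - z * ?\<psi> t = unit_at \<nu> t + (\<Sum>u\<in>W. defect \<theta> \<omega> ?\<psi> u * unit_at u t)" for t
    using eq[of t] by (simp add: algebra_simps)
  \<comment> \<open>The full column solves the decoupled equation with additional sources on
    \<open>W\<close>; by uniqueness it is the corresponding combination of decoupled
    columns.\<close>
  then have 1: "solves ?\<theta> \<omega> z (\<lambda>t. unit_at \<nu> t + (\<Sum>u\<in>W. defect \<theta> \<omega> ?\<psi> u * unit_at u t)) ?\<psi>"
    using l2 by (simp add: solves_def)
  have 2: "solves ?\<theta> \<omega> z (\<lambda>t. unit_at \<nu> t + (\<Sum>u\<in>W. defect \<theta> \<omega> ?\<psi> u * unit_at u t))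
      (\<lambda>t. green ?\<theta> \<omega> z \<nu> t + (\<Sum>u\<in>W. defect \<theta> \<omega> ?\<psi> u * green ?\<theta> \<omega> z u t))"
    by (intro solves_add solves_sum solves_cmult solves_green assms pd)
  have "?\<psi> \<mu> = green ?\<theta> \<omega> z \<nu> \<mu> + (\<Sum>u\<in>W. defect \<theta> \<omega> ?\<psi> u * green ?\<theta> \<omega> z u \<mu>)"
    using solves_unique[OF assms(1) pd assms(3) 1 2] by metis
  also have "(\<Sum>u\<in>W. defect \<theta> \<omega> ?\<psi> u * green ?\<theta> \<omega> z u \<mu>)
      = (\<Sum>u\<in>?B. defect \<theta> \<omega> ?\<psi> u * green ?\<theta> \<omega> z u \<mu>) + (\<Sum>u\<in>rim c. defect \<theta> \<omega> ?\<psi> u * green ?\<theta> \<omega> z u \<mu>)"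
    unfolding W_def using fin by (intro sum.union_disjoint) (auto simp: rim_def)
  also have "(\<Sum>u\<in>?B. defect \<theta> \<omega> ?\<psi> u * green ?\<theta> \<omega> z u \<mu>) = 0"
    using assms by (intro sum.neutral) (auto simp: c_def green_decouple_zero)
  also have "green ?\<theta> \<omega> z \<nu> \<mu> = 0"
    using assms by (simp add: c_def green_decouple_zero)
  finally show ?thesis by (simp add: c_def)
qed

text \<open>The defect at \<open>t\<close> involves the value at \<open>ccw_inv t\<close>, outside the cell. The equation at
  \<open>partner t\<close> expresses \<open>sin (\<theta> t)\<close> times that value through values inside the cell, and
  \<open>1 - cos \<le> sin\<^sup>2\<close> provides the factor \<open>sin (\<theta> t)\<close>.\<close>

lemma defect_bound:
  fixes \<nu> :: site
  assumes "unimod \<omega>" "paired \<theta>" "norm z \<noteq> 1" "\<bar>\<theta> t\<bar> \<le> r" "r \<le> 1"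
  defines "\<psi> \<equiv> green \<theta> \<omega> z \<nu>"
  shows "norm (defect \<theta> \<omega> \<psi> t)
      \<le> r * (1 + norm z * norm (\<psi> (partner t)) + 2 * norm (\<psi> (cw_inv t)))"
proof -
  let ?c = "cos (\<theta> t)" and ?s = "sin (\<theta> t)"
  let ?a = "\<psi> (ccw_inv t)" and ?b = "\<psi> (cw_inv t)"
  have \<theta>: "\<theta> (partner t) = \<theta> t" using assms(2) by (simp add: paired_def)
  have nw: "norm (\<omega> y) = 1" for y using assms(1) by (simp add: unimod_def)
  have c: "0 \<le> ?c" "?c \<le> 1"
    using assms(4,5) pi_gt3 by (auto intro!: cos_ge_zero)
  have "hop \<theta> \<omega> \<psi> (partner t) - z * \<psi> (partner t) = unit_at \<nu> (partner t)"
    using solves_green[OF assms(1-3)] by (auto simp: solves_def \<psi>_def)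
  then have "\<omega> (partner t) * (?c * ?b + \<i> * ?s * ?a) = unit_at \<nu> (partner t) + z * \<psi> (partner t)"
    by (simp add: hop_def \<theta> algebra_simps)
  then have "norm (?c * ?b + \<i> * ?s * ?a) = norm (unit_at \<nu> (partner t) + z * \<psi> (partner t))"
    by (metis nw norm_mult mult_1)
  also have "\<dots> \<le> 1 + norm z * norm (\<psi> (partner t))"
    by (rule order_trans[OF norm_triangle_ineq]) (auto simp: unit_at_def norm_mult)
  finally have e: "norm (?c * ?b + \<i> * ?s * ?a) \<le> 1 + norm z * norm (\<psi> (partner t))" .
  have "norm (\<i> * ?s * ?a) \<le> norm (?c * ?b + \<i> * ?s * ?a) + norm (?c * ?b)"
    by (metis add_diff_cancel_left' norm_triangle_ineq4)
  also have "norm (?c * ?b) \<le> norm ?b"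
    using c by (simp add: norm_mult mult_left_le_one_le)
  finally have sa: "\<bar>?s\<bar> * norm ?a \<le> 1 + norm z * norm (\<psi> (partner t)) + norm ?b"
    using e by (simp add: norm_mult)
  have "?c * ?c \<le> ?c * 1" using c by (intro mult_left_mono)
  then have "1 - ?c \<le> \<bar>?s\<bar> * \<bar>?s\<bar>"
    using sin_cos_squared_add[of "\<theta> t"] by (simp add: power2_eq_square)
  then have "(1 - ?c) * norm ?a \<le> \<bar>?s\<bar> * \<bar>?s\<bar> * norm ?a" by (intro mult_right_mono) auto
  also have "\<dots> \<le> \<bar>?s\<bar> * (1 + norm z * norm (\<psi> (partner t)) + norm ?b)"
    unfolding mult.assoc by (intro mult_left_mono sa) auto
  finally have ca: "(1 - ?c) * norm ?a \<le> \<bar>?s\<bar> * (1 + norm z * norm (\<psi> (partner t)) + norm ?b)" .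
  have "norm (defect \<theta> \<omega> \<psi> t) = norm ((1 - ?c) * ?a - \<i> * ?s * ?b)"
    by (simp add: defect_def norm_mult nw)
  also have "\<dots> \<le> norm ((1 - ?c) * ?a) + norm (\<i> * ?s * ?b)" by (rule norm_triangle_ineq4)
  also have "\<dots> = (1 - ?c) * norm ?a + \<bar>?s\<bar> * norm ?b"
    using c by (simp add: norm_mult del: of_real_diff)
  \<comment> \<open>The coefficient 2 collects one copy of \<open>norm ?b\<close> from eliminating
    the outer value and one from the sine term of the defect.\<close>
  also have "\<dots> \<le> \<bar>?s\<bar> * (1 + norm z * norm (\<psi> (partner t)) + 2 * norm ?b)"
    using ca by (simp add: algebra_simps)
  also have "\<dots> \<le> r * (1 + norm z * norm (\<psi> (partner t)) + 2 * norm ?b)"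
    using abs_sin_x_le_abs_x[of "\<theta> t"] assms(4) by (intro mult_right_mono) auto
  finally show ?thesis .
qed

text \<open>Apply u \<le> u^s on [0,1] to the fractions x/(x+y) and y/(x+y), which add up to
  1.\<close>

lemma powr_add_le:
  fixes x y s :: real
  assumes "0 < s" "s \<le> 1" "0 \<le> x" "0 \<le> y"
  shows "(x + y) powr s \<le> x powr s + y powr s"
proof (cases "x + y = 0")
  case False
  then have pos: "0 < x + y" using assms by simp
  have "u \<le> u powr s" if "0 \<le> u" "u \<le> 1" for u :: real
    using that assms powr_mono'[of s 1 u] by (cases "u = 0") auto
  then have "x / (x + y) + y / (x + y) \<le> (x / (x + y)) powr s + (y / (x + y)) powr s"
    using assms pos by (intro add_mono) auto
  also have "x / (x + y) + y / (x + y) = 1" using pos by (simp add: add_divide_distrib[symmetric])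
  also have "(x / (x + y)) powr s + (y / (x + y)) powr s = (x powr s + y powr s) / (x + y) powr s"
    using assms by (simp add: powr_divide add_divide_distrib)
  finally show ?thesis using pos by (simp add: le_divide_eq)
qed (use assms in auto)

lemma powr_sum_le:
  fixes f :: "'a \<Rightarrow> real"
  assumes "0 < s" "s \<le> 1" "\<And>i. i \<in> A \<Longrightarrow> 0 \<le> f i"
  shows "(\<Sum>i\<in>A. f i) powr s \<le> (\<Sum>i\<in>A. f i powr s)"
  using assms(3)
proof (induction A rule: infinite_finite_induct)
  case (insert i A)
  have "(\<Sum>i\<in>insert i A. f i) powr s \<le> f i powr s + (\<Sum>i\<in>A. f i) powr s"
    using insert assms powr_add_le[of s "f i" "\<Sum>i\<in>A. f i"] by (simp add: sum_nonneg)
  then show ?case using insert by force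
qed auto

text \<open>Of the weights max 1 |z|, one goes with the decoupled factor; those of the full entries
  absorb the |z| produced by \<open>defect_bound\<close>. Subadditivity of the s-th power then
  splits everything into products of two moments.\<close>

lemma moment_step:
  assumes "0 < s" "s \<le> 1" "unimod \<omega>" "paired \<theta>" "norm z \<noteq> 1"
    and "\<And>t. \<bar>\<theta> t\<bar> \<le> r" "r \<le> 1" "cell \<mu> \<noteq> cell \<nu>"
  shows "moment s \<theta> z \<nu> \<mu> \<omega> \<le> (\<Sum>t\<in>rim (cell \<nu>). ennreal (r powr s) *
      (moment s (decouple (cell \<nu>) \<theta>) z t \<mu> \<omega>
       + moment s (decouple (cell \<nu>) \<theta>) z t \<mu> \<omega> * moment s \<theta> z \<nu> (partner t) \<omega>
       + 2 * (moment s (decouple (cell \<nu>) \<theta>) z t \<mu> \<omega> * moment s \<theta> z \<nu> (cw_inv t) \<omega>)))"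
proof -
  let ?m = "max 1 (norm z)"
  let ?\<psi> = "green \<theta> \<omega> z \<nu>" and ?T = "rim (cell \<nu>)"
  let ?g = "\<lambda>t. norm (green (decouple (cell \<nu>) \<theta>) \<omega> z t \<mu>)"
  let ?p = "\<lambda>t. ?m * norm (?\<psi> (partner t))" and ?q = "\<lambda>t. ?m * norm (?\<psi> (cw_inv t))"
  have r: "0 \<le> r" using assms(6)[of \<nu>] by linarith
  have "?m * norm (?\<psi> \<mu>) \<le> ?m * (\<Sum>t\<in>?T. norm (defect \<theta> \<omega> ?\<psi> t) * ?g t)"
    unfolding green_expansion[OF assms(3-5,8)]
    by (intro mult_left_mono order_trans[OF norm_sum]) (auto simp: norm_mult)
  also have "\<dots> = (\<Sum>t\<in>?T. norm (defect \<theta> \<omega> ?\<psi> t) * (?m * ?g t))"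
    by (simp add: sum_distrib_left mult_ac)
  also have "\<dots> \<le> (\<Sum>t\<in>?T. (r * (1 + ?p t + 2 * ?q t)) * (?m * ?g t))"
  proof (intro sum_mono mult_right_mono)
    fix t
    have "norm z * norm (?\<psi> (partner t)) \<le> ?p t" "1 * norm (?\<psi> (cw_inv t)) \<le> ?q t"
      by (intro mult_right_mono; simp)+
    then have "r * (1 + norm z * norm (?\<psi> (partner t)) + 2 * norm (?\<psi> (cw_inv t))) \<le> r * (1 + ?p t + 2 * ?q t)"
      using r by (intro mult_left_mono; linarith)
    then show "norm (defect \<theta> \<omega> ?\<psi> t) \<le> r * (1 + ?p t + 2 * ?q t)"
      using defect_bound[OF assms(3-5,6,7), of \<nu> t] by linarith
  qed auto
  finally have "(?m * norm (?\<psi> \<mu>)) powr s \<le> (\<Sum>t\<in>?T. (r * (1 + ?p t + 2 * ?q t)) * (?m * ?g t)) powr s"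
    using assms(1) by (intro powr_mono2) auto
  also have "\<dots> \<le> (\<Sum>t\<in>?T. ((r * (1 + ?p t + 2 * ?q t)) * (?m * ?g t)) powr s)"
    using assms(1,2) r by (intro powr_sum_le) auto
  also have "\<dots> \<le> (\<Sum>t\<in>?T. r powr s * ((?m * ?g t) powr s + (?m * ?g t) powr s * ?p t powr s
      + 2 * ((?m * ?g t) powr s * ?q t powr s)))"
  proof (intro sum_mono)
    fix t
    have p: "?p t \<ge> 0" and q: "?q t \<ge> 0" by auto
    have "(1 + ?p t + 2 * ?q t) powr s \<le> (1 + ?p t) powr s + (2 * ?q t) powr s"
      using assms(1,2) p q by (intro powr_add_le) auto
    also have "(1 + ?p t) powr s \<le> 1 powr s + ?p t powr s"
      using assms(1,2) p by (intro powr_add_le) auto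
    also have "(2 * ?q t) powr s = 2 powr s * ?q t powr s" using q by (simp add: powr_mult)
    also have "\<dots> \<le> 2 powr 1 * ?q t powr s"
      using assms(2) by (intro mult_right_mono powr_mono) auto
    finally have "(1 + ?p t + 2 * ?q t) powr s \<le> 1 + ?p t powr s + 2 * ?q t powr s" by simp
    then have "r powr s * ((?m * ?g t) powr s * (1 + ?p t + 2 * ?q t) powr s)
        \<le> r powr s * ((?m * ?g t) powr s * (1 + ?p t powr s + 2 * ?q t powr s))"
      by (intro mult_left_mono) auto
    moreover have "((r * (1 + ?p t + 2 * ?q t)) * (?m * ?g t)) powr s
        = r powr s * ((?m * ?g t) powr s * (1 + ?p t + 2 * ?q t) powr s)"
    proof -
      define h u where "h = ?m * ?g t" and "u = 1 + ?p t + 2 * ?q t"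
      have "0 \<le> h" "0 \<le> u" using p q by (simp_all add: h_def u_def)
      then show ?thesis using r unfolding h_def[symmetric] u_def[symmetric]
        by (simp add: powr_mult mult_ac)
    qed
    ultimately show "((r * (1 + ?p t + 2 * ?q t)) * (?m * ?g t)) powr s
       \<le> r powr s * ((?m * ?g t) powr s + (?m * ?g t) powr s * ?p t powr s
      + 2 * ((?m * ?g t) powr s * ?q t powr s))"
      by (simp add: algebra_simps)
  qed
  finally have "moment s \<theta> z \<nu> \<mu> \<omega> \<le> ennreal (\<Sum>t\<in>?T. r powr s * ((?m * ?g t) powr s
      + (?m * ?g t) powr s * ?p t powr s + 2 * ((?m * ?g t) powr s * ?q t powr s)))"
    unfolding moment_def by (rule ennreal_leI)
  also have "\<dots> = (\<Sum>t\<in>?T. ennreal (r powr s) * (ennreal ((?m * ?g t) powr s)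
      + ennreal ((?m * ?g t) powr s) * ennreal (?p t powr s)
      + 2 * (ennreal ((?m * ?g t) powr s) * ennreal (?q t powr s))))"
    by (subst sum_ennreal[symmetric]) (simp_all add: ennreal_mult ennreal_plus)
  finally show ?thesis by (simp add: moment_def)
qed

section \<open>Exponential decay\<close>

lemma measurable_moment [measurable]: "moment s \<theta> z \<nu> \<mu> \<in> borel_measurable Pomega"
  unfolding moment_def by measurable

lemma space_Pomega: "space Pomega = UNIV"
  by (simp add: Pomega_def space_PiM circle_measure_def)

lemma measurable_upd:
  assumes "f \<in> borel_measurable Pomega"
  shows "(\<lambda>w. f (fun_upd \<omega> x w)) \<in> borel_measurable circle_measure"
proof -
  have "(\<lambda>w. (w, \<omega>)) \<in> measurable circle_measure (circle_measure \<Otimes>\<^sub>M Pomega)"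
    by (rule measurable_Pair) (auto simp: space_Pomega)
  from measurable_compose[OF measurable_compose[OF this measurable_fun_upd_Pomega] assms]
  show ?thesis by simp
qed

lemma measurable_upd_integral:
  assumes "f \<in> borel_measurable Pomega"
  shows "(\<lambda>\<omega>. \<integral>\<^sup>+ w. f (fun_upd \<omega> x w) \<partial>circle_measure) \<in> borel_measurable Pomega"
proof -
  interpret C: prob_space circle_measure by (rule prob_space_circle)
  have "(\<lambda>(\<omega>, w). (w, \<omega>)) \<in> measurable (Pomega \<Otimes>\<^sub>M circle_measure) (circle_measure \<Otimes>\<^sub>M Pomega)"
    by measurable
  from measurable_compose[OF measurable_compose[OF this measurable_fun_upd_Pomega[of x]] assms]
  have "(\<lambda>(\<omega>, w). f (fun_upd \<omega> x w)) \<in> borel_measurable (Pomega \<Otimes>\<^sub>M circle_measure)"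
    by (simp add: split_beta')
  then show ?thesis by (rule C.borel_measurable_nn_integral)
qed

text \<open>The phases at \<open>x\<close> and \<nu> are averaged first, with F acting as a
  constant. When the two sites coincide a single phase is averaged, and its bound K is weakened to K
  * K.\<close>

lemma expectation_factor:
  assumes "0 < s" and K: "K \<ge> 1" "\<And>a. (\<integral>\<^sup>+ w. rpow s (norm (w - a)) \<partial>circle_measure) \<le> ennreal K"
    and th: "paired \<theta>" "norm z \<noteq> 1" and F [measurable]: "F \<in> borel_measurable Pomega"
    and inv: "\<And>\<omega> y w. unimod \<omega> \<Longrightarrow> norm w = 1 \<Longrightarrow> y \<in> {x, \<nu>} \<Longrightarrow> F (fun_upd \<omega> y w) = F \<omega>"
  shows "(\<integral>\<^sup>+ \<omega>. F \<omega> * moment s \<theta> z \<nu> x \<omega> \<partial>Pomega) \<le> ennreal (K * K) * (\<integral>\<^sup>+ \<omega>. F \<omega> \<partial>Pomega)"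
proof -
  let ?M = "moment s \<theta> z \<nu> x"
  have FM: "(\<lambda>\<omega>. F \<omega> * ?M \<omega>) \<in> borel_measurable Pomega" by measurable
  have KK: "ennreal K \<le> ennreal (K * K)"
    using K(1) mult_left_mono[of 1 K K] by (intro ennreal_leI) auto
  have "(\<integral>\<^sup>+ \<omega>. F \<omega> * ?M \<omega> \<partial>Pomega) \<le> (\<integral>\<^sup>+ \<omega>. F \<omega> * ennreal (K * K) \<partial>Pomega)"
  proof (cases "x = \<nu>")
    case True
    have "(\<integral>\<^sup>+ \<omega>. F \<omega> * ?M \<omega> \<partial>Pomega)
        = (\<integral>\<^sup>+ \<omega>. \<integral>\<^sup>+ w. F (fun_upd \<omega> \<nu> w) * ?M (fun_upd \<omega> \<nu> w) \<partial>circle_measure \<partial>Pomega)"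
      by (rule nn_integral_resample[OF FM])
    also have "\<dots> \<le> (\<integral>\<^sup>+ \<omega>. F \<omega> * ennreal (K * K) \<partial>Pomega)"
    proof (rule nn_integral_mono_AE)
      show "AE \<omega> in Pomega. (\<integral>\<^sup>+ w. F (fun_upd \<omega> \<nu> w) * ?M (fun_upd \<omega> \<nu> w) \<partial>circle_measure)
          \<le> F \<omega> * ennreal (K * K)"
        using AE_unimod
      proof eventually_elim
        case (elim \<omega>)
        have "(\<integral>\<^sup>+ w. F (fun_upd \<omega> \<nu> w) * ?M (fun_upd \<omega> \<nu> w) \<partial>circle_measure)
            = (\<integral>\<^sup>+ w. F \<omega> * ?M (fun_upd \<omega> \<nu> w) \<partial>circle_measure)"
          using AE_circle_norm by (intro nn_integral_cong_AE) (auto simp: inv[OF elim])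
        also have "\<dots> = F \<omega> * (\<integral>\<^sup>+ w. ?M (fun_upd \<omega> \<nu> w) \<partial>circle_measure)"
          by (rule nn_integral_cmult[OF measurable_upd[OF measurable_moment]])
        also have "\<dots> \<le> F \<omega> * ennreal (K * K)"
          unfolding True using apriori_diag[OF assms(1) K elim th, of \<nu>] KK
          by (intro mult_left_mono) (auto intro: order_trans)
        finally show ?case .
      qed
    qed
    finally show ?thesis .
  next
    case False
    have "(\<integral>\<^sup>+ \<omega>. F \<omega> * ?M \<omega> \<partial>Pomega)
        = (\<integral>\<^sup>+ \<omega>. \<integral>\<^sup>+ v. F (fun_upd \<omega> x v) * ?M (fun_upd \<omega> x v) \<partial>circle_measure \<partial>Pomega)"
      by (rule nn_integral_resample[OF FM])
    also have "\<dots> = (\<integral>\<^sup>+ \<omega>. \<integral>\<^sup>+ w. \<integral>\<^sup>+ v. F (fun_upd (fun_upd \<omega> \<nu> w) x v)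
        * ?M (fun_upd (fun_upd \<omega> \<nu> w) x v) \<partial>circle_measure \<partial>circle_measure \<partial>Pomega)"
      by (rule nn_integral_resample[OF measurable_upd_integral[OF FM]])
    also have "\<dots> \<le> (\<integral>\<^sup>+ \<omega>. F \<omega> * ennreal (K * K) \<partial>Pomega)"
    proof (rule nn_integral_mono_AE)
      show "AE \<omega> in Pomega. (\<integral>\<^sup>+ w. \<integral>\<^sup>+ v. F (fun_upd (fun_upd \<omega> \<nu> w) x v)
          * ?M (fun_upd (fun_upd \<omega> \<nu> w) x v) \<partial>circle_measure \<partial>circle_measure) \<le> F \<omega> * ennreal (K * K)"
        using AE_unimod
      proof eventually_elim
        case (elim \<omega>)
        have *: "(\<integral>\<^sup>+ v. F (fun_upd (fun_upd \<omega> \<nu> w) x v) * ?M (fun_upd (fun_upd \<omega> \<nu> w) x v) \<partial>circle_measure)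
            = F \<omega> * (\<integral>\<^sup>+ v. ?M (fun_upd (fun_upd \<omega> \<nu> w) x v) \<partial>circle_measure)" if w: "norm w = 1" for w
        proof -
          have F: "F (fun_upd (fun_upd \<omega> \<nu> w) x v) = F \<omega>" if "norm v = 1" for v
            using inv[OF unimod_fun_upd[OF elim w] that, of x] inv[OF elim w, of \<nu>] by simp
          have "(\<integral>\<^sup>+ v. F (fun_upd (fun_upd \<omega> \<nu> w) x v) * ?M (fun_upd (fun_upd \<omega> \<nu> w) x v) \<partial>circle_measure)
            = (\<integral>\<^sup>+ v. F \<omega> * ?M (fun_upd (fun_upd \<omega> \<nu> w) x v) \<partial>circle_measure)"
          proof (rule nn_integral_cong_AE)
            show "AE v in circle_measure. F (fun_upd (fun_upd \<omega> \<nu> w) x v) * ?M (fun_upd (fun_upd \<omega> \<nu> w) x v)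
                = F \<omega> * ?M (fun_upd (fun_upd \<omega> \<nu> w) x v)"
              using AE_circle_norm by eventually_elim (simp only: F)
          qed
          also have "\<dots> = F \<omega> * (\<integral>\<^sup>+ v. ?M (fun_upd (fun_upd \<omega> \<nu> w) x v) \<partial>circle_measure)"
            by (rule nn_integral_cmult[OF measurable_upd[OF measurable_moment]])
          finally show ?thesis .
        qed
        have "(\<integral>\<^sup>+ w. \<integral>\<^sup>+ v. F (fun_upd (fun_upd \<omega> \<nu> w) x v)
            * ?M (fun_upd (fun_upd \<omega> \<nu> w) x v) \<partial>circle_measure \<partial>circle_measure)
          = (\<integral>\<^sup>+ w. F \<omega> * (\<integral>\<^sup>+ v. ?M (fun_upd (fun_upd \<omega> \<nu> w) x v) \<partial>circle_measure) \<partial>circle_measure)"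
        proof (rule nn_integral_cong_AE)
          show "AE w in circle_measure. (\<integral>\<^sup>+ v. F (fun_upd (fun_upd \<omega> \<nu> w) x v)
              * ?M (fun_upd (fun_upd \<omega> \<nu> w) x v) \<partial>circle_measure)
            = F \<omega> * (\<integral>\<^sup>+ v. ?M (fun_upd (fun_upd \<omega> \<nu> w) x v) \<partial>circle_measure)"
            using AE_circle_norm by eventually_elim (rule *)
        qed
        also have "\<dots> = F \<omega> * (\<integral>\<^sup>+ w. \<integral>\<^sup>+ v. ?M (fun_upd (fun_upd \<omega> \<nu> w) x v) \<partial>circle_measure \<partial>circle_measure)"
          by (rule nn_integral_cmult[OF measurable_upd[OF measurable_upd_integral[OF measurable_moment]]])
        also have "\<dots> \<le> F \<omega> * ennreal (K * K)"
          by (intro mult_left_mono apriori_offdiag[OF assms(1) K elim th False]) auto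
        finally show ?case .
      qed
    qed
    finally show ?thesis .
  qed
  also have "\<dots> = ennreal (K * K) * (\<integral>\<^sup>+ \<omega>. F \<omega> \<partial>Pomega)"
    by (subst nn_integral_multc) (auto simp: mult.commute)
  finally show ?thesis .
qed

text \<open>The angle field is generalized because the induction hypothesis is applied to the
  decoupled field, with the source moved to the rim. The case n = 0 is the a priori bound; every
  further round gains exp (-1) from the smallness of \<open>r\<close>.\<close>

lemma moment_decay:
  assumes s: "0 < s" "s < 1"
    and K: "K \<ge> 1" "\<And>a. (\<integral>\<^sup>+ w. rpow s (norm (w - a)) \<partial>circle_measure) \<le> ennreal K"
    and r: "0 < r" "r \<le> 1" "4 * (r powr s * (1 + 3 * (K * K))) \<le> exp (- 1)"
    and z: "norm z \<noteq> 1"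
    and \<theta>: "paired \<theta>" "\<And>t. \<bar>\<theta> t\<bar> \<le> r" "5 * int n \<le> dist1 \<mu> \<nu>"
  shows "(\<integral>\<^sup>+ \<omega>. moment s \<theta> z \<nu> \<mu> \<omega> \<partial>Pomega) \<le> ennreal (K * K * exp (- real n))"
  using \<theta>
proof (induction n arbitrary: \<theta> \<mu> \<nu>)
  case 0
  interpret P: prob_space Pomega by (rule prob_space_Pomega)
  have "(\<integral>\<^sup>+ \<omega>. 1 * moment s \<theta> z \<nu> \<mu> \<omega> \<partial>Pomega) \<le> ennreal (K * K) * (\<integral>\<^sup>+ \<omega>. 1 \<partial>Pomega)"
    by (rule expectation_factor[OF s(1) K 0(1) z]) auto
  then show ?case by (simp add: P.emeasure_space_1)
next
  case (Suc n)
  define c where "c = cell \<nu>"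
  let ?E = "K * K * exp (- real n)"
  have "\<not> dist1 \<mu> \<nu> \<le> 2" using Suc.prems(3) by simp
  then have \<mu>: "cell \<mu> \<noteq> c" using dist1_same_cell unfolding c_def by blast
  define G where "G = (\<lambda>t. moment s (decouple c \<theta>) z t \<mu>)"
  have [measurable]: "G t \<in> borel_measurable Pomega" for t unfolding G_def by measurable
  have pd: "paired (decouple c \<theta>)" by (rule paired_decouple[OF Suc.prems(1)])
  have G: "(\<integral>\<^sup>+ \<omega>. G t \<omega> \<partial>Pomega) \<le> ennreal ?E" if "t \<in> rim c" for t
    unfolding G_def
  proof (rule Suc.IH[OF pd decouple_le[OF Suc.prems(2)]])
    \<comment> \<open>From \<nu> to \<open>partner t\<close> is at most 2, and from there to
      \<open>t\<close> at most 2 more, so a round loses at most 4 of the 5 available units.\<close>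
    have "dist1 (partner t) \<nu> \<le> 2" using that by (intro dist1_same_cell) (auto simp: rim_def c_def)
    then show "5 * int n \<le> dist1 \<mu> t"
      using Suc.prems(3) dist1_triangle[of \<mu> \<nu> t] dist1_triangle[of t \<nu> "partner t"] dist1_partner[of t] by simp
  qed
  have GM: "(\<integral>\<^sup>+ \<omega>. G t \<omega> * moment s \<theta> z \<nu> x \<omega> \<partial>Pomega) \<le> ennreal (K * K) * (\<integral>\<^sup>+ \<omega>. G t \<omega> \<partial>Pomega)"
    if "t \<in> rim c" "cell x = c" for t x
  proof (rule expectation_factor[OF s(1) K Suc.prems(1) z])
    fix \<omega> :: wave and y and w :: complex assume un: "unimod \<omega>" "norm w = 1" and y: "y \<in> {x, \<nu>}"
    have "cell y = c" using y that(2) by (auto simp: c_def)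
    then have "green (decouple c \<theta>) (fun_upd \<omega> y w) z t \<mu> = green (decouple c \<theta>) \<omega> z t \<mu>"
      using that(1) \<mu> by (intro green_decouple_local[OF un(1) unimod_fun_upd[OF un] Suc.prems(1) z])
        (auto simp: rim_def)
    then show "G t (fun_upd \<omega> y w) = G t \<omega>" by (simp add: G_def moment_def)
  qed measurable
  let ?r = "ennreal (r powr s)"
  let ?H = "\<lambda>t \<omega>. G t \<omega> + G t \<omega> * moment s \<theta> z \<nu> (partner t) \<omega> + 2 * (G t \<omega> * moment s \<theta> z \<nu> (cw_inv t) \<omega>)"
  \<comment> \<open>The three terms contribute 1, K * K and 2 * (K * K) times the decoupled moment,
    whence 1 + 3 * (K * K).\<close>
  have H: "(\<integral>\<^sup>+ \<omega>. ?H t \<omega> \<partial>Pomega) \<le> ennreal ((1 + 3 * (K * K)) * ?E)" if t: "t \<in> rim c" for t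
  proof -
    have "(\<integral>\<^sup>+ \<omega>. ?H t \<omega> \<partial>Pomega) = (\<integral>\<^sup>+ \<omega>. G t \<omega> \<partial>Pomega)
        + (\<integral>\<^sup>+ \<omega>. G t \<omega> * moment s \<theta> z \<nu> (partner t) \<omega> \<partial>Pomega)
        + 2 * (\<integral>\<^sup>+ \<omega>. G t \<omega> * moment s \<theta> z \<nu> (cw_inv t) \<omega> \<partial>Pomega)"
      by (simp add: nn_integral_add nn_integral_cmult)
    also have "\<dots> \<le> ennreal ?E + ennreal (K * K) * ennreal ?E + 2 * (ennreal (K * K) * ennreal ?E)"
      using t by (intro add_mono mult_left_mono G[OF t] order_trans[OF GM[OF t]])
        (auto simp: rim_def cell_cw_inv)
    also have "\<dots> = ennreal ((1 + 3 * (K * K)) * ?E)"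
    proof -
      define a where "a = K * K"
      define e where "e = K * K * exp (- real n)"
      have "0 \<le> a" "0 \<le> e" by (auto simp: a_def e_def)
      then have "ennreal a * ennreal e = ennreal (a * e)" "2 * ennreal (a * e) = ennreal (2 * (a * e))"
        "ennreal e + ennreal (a * e) + ennreal (2 * (a * e)) = ennreal (e + a * e + 2 * (a * e))"
        by (simp_all only: ennreal_mult ennreal_plus ennreal_numeral mult_nonneg_nonneg add_nonneg_nonneg zero_le_numeral)
      then have "ennreal e + ennreal a * ennreal e + 2 * (ennreal a * ennreal e)
          = ennreal (e + a * e + 2 * (a * e))"
        by simp
      also have "e + a * e + 2 * (a * e) = (1 + 3 * a) * e" by (simp add: algebra_simps)
      finally show ?thesis unfolding a_def e_def .
    qed
    finally show ?thesis .
  qed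
  have "(\<integral>\<^sup>+ \<omega>. moment s \<theta> z \<nu> \<mu> \<omega> \<partial>Pomega) \<le> (\<integral>\<^sup>+ \<omega>. (\<Sum>t\<in>rim c. ?r * ?H t \<omega>) \<partial>Pomega)"
  proof (rule nn_integral_mono_AE)
    show "AE \<omega> in Pomega. moment s \<theta> z \<nu> \<mu> \<omega> \<le> (\<Sum>t\<in>rim c. ?r * ?H t \<omega>)"
      using AE_unimod
    proof eventually_elim
      case (elim \<omega>)
      show ?case
        using moment_step[OF s(1) less_imp_le[OF s(2)] elim Suc.prems(1) z Suc.prems(2) r(2) \<mu>[unfolded c_def]]
        by (simp add: G_def c_def)
    qed
  qed
  also have "\<dots> = (\<Sum>t\<in>rim c. ?r * (\<integral>\<^sup>+ \<omega>. ?H t \<omega> \<partial>Pomega))"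
    by (subst nn_integral_sum) (auto intro!: sum.cong nn_integral_cmult)
  also have "\<dots> \<le> (\<Sum>t\<in>rim c. ?r * ennreal ((1 + 3 * (K * K)) * ?E))"
    by (intro sum_mono mult_left_mono H) auto
  also have "\<dots> = ennreal (real (card (rim c)) * (r powr s * ((1 + 3 * (K * K)) * ?E)))"
    by (simp add: ennreal_mult ennreal_of_nat_eq_real_of_nat)
  also have "\<dots> \<le> ennreal (4 * (r powr s * ((1 + 3 * (K * K)) * ?E)))"
    using card_rim[of c] by (intro ennreal_leI mult_right_mono) auto
  also have "\<dots> \<le> ennreal (exp (- 1) * ?E)"
  proof (intro ennreal_leI)
    have "4 * (r powr s * (1 + 3 * (K * K))) * ?E \<le> exp (- 1) * ?E"
      using r(3) by (intro mult_right_mono) auto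
    then show "4 * (r powr s * ((1 + 3 * (K * K)) * ?E)) \<le> exp (- 1) * ?E" by (simp only: mult.assoc)
  qed
  also have "exp (- 1) * ?E = K * K * exp (- real (Suc n))"
    by (simp add: exp_diff exp_minus field_simps exp_add)
  finally show ?case .
qed

theorem theorem3:
  fixes s :: real
  assumes "0 < s" and "s < 1"
  shows "\<exists>\<phi>0 c g. \<phi>0 > 0 \<and> c > 0 \<and> g > 0 \<and>
     (\<forall>\<phi>::real. \<forall>\<mu> \<nu> :: site. \<forall>z::complex. \<bar>\<phi>\<bar> \<le> \<phi>0 \<longrightarrow> norm z \<noteq> 1 \<longrightarrow>
        (\<integral>\<^sup>+ \<omega>. ennreal (norm (resolvent_entry \<omega> \<phi> z \<mu> \<nu>) powr s) \<partial>Pomega)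
          \<le> ennreal (c * exp (- g * site_dist \<mu> \<nu>)))"
proof -
  obtain K where K: "K \<ge> 1" "\<And>a. (\<integral>\<^sup>+ w. rpow s (norm (w - a)) \<partial>circle_measure) \<le> ennreal K"
    using circle_rpow_bounded[OF assms] by blast
  \<comment> \<open>The value of \<open>r powr s\<close> for which the smallness condition of
    \<open>moment_decay\<close> is an equality; its 4 is the bound on the rim.\<close>
  define q where "q = exp (- 1) / (4 * (1 + 3 * (K * K)))"
  define r where "r = q powr (1 / s)"
  have pos: "0 < 1 + 3 * (K * K)" using K(1) by (simp add: add_pos_nonneg)
  have q: "0 < q" using pos by (simp add: q_def)
  have "q \<le> 1"
  proof -
    have "exp (- 1) \<le> (1 :: real)" by simp
    also have "1 \<le> 4 * (1 + 3 * (K * K))" by (simp add: add_increasing2)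
    finally show ?thesis using pos by (simp add: q_def)
  qed
  then have r: "0 < r" "r \<le> 1" using q assms by (auto simp: r_def powr_le1)
  have "r powr s = q" using q assms by (simp add: r_def powr_powr)
  then have small: "4 * (r powr s * (1 + 3 * (K * K))) \<le> exp (- 1)"
    using pos by (simp add: q_def field_simps)
  show ?thesis
  proof (rule exI[of _ r], rule exI[of _ "K * K * exp 1"], rule exI[of _ "1 / 5"], intro conjI allI impI)
    fix \<phi> :: real and \<mu> \<nu> :: site and z :: complex
    assume \<phi>: "\<bar>\<phi>\<bar> \<le> r" and z: "norm z \<noteq> 1"
    \<comment> \<open>Rounding down gives n \<ge> d/5 - 4/5 for the distance d, hence the rate 1/5
      and the extra factor \<open>exp 1\<close> in the constant.\<close>
    define n where "n = nat (dist1 \<mu> \<nu> div 5)"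
    have d: "0 \<le> dist1 \<mu> \<nu>" by (simp add: dist1_def)
    then have n: "5 * int n \<le> dist1 \<mu> \<nu>" "dist1 \<mu> \<nu> \<le> 5 * int n + 4" unfolding n_def by linarith+
    have "site_dist \<mu> \<nu> \<le> real_of_int (dist1 \<mu> \<nu>)"
      unfolding site_dist_def dist1_def of_int_add of_int_abs of_int_diff
      by (rule sqrt_sum_squares_le_sum_abs)
    also have "\<dots> \<le> 5 * real n + 4" using n(2) by linarith
    finally have sd: "- real n \<le> 1 + - (1 / 5) * site_dist \<mu> \<nu>" by simp
    have "(\<integral>\<^sup>+ \<omega>. ennreal (norm (resolvent_entry \<omega> \<phi> z \<mu> \<nu>) powr s) \<partial>Pomega)
        \<le> (\<integral>\<^sup>+ \<omega>. moment s (\<lambda>_. \<phi>) z \<nu> \<mu> \<omega> \<partial>Pomega)"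
    proof (rule nn_integral_mono_AE)
      show "AE \<omega> in Pomega. ennreal (norm (resolvent_entry \<omega> \<phi> z \<mu> \<nu>) powr s) \<le> moment s (\<lambda>_. \<phi>) z \<nu> \<mu> \<omega>"
        using AE_unimod
      proof eventually_elim
        case (elim \<omega>)
        have "1 * norm (green (\<lambda>_. \<phi>) \<omega> z \<nu> \<mu>) \<le> max 1 (norm z) * norm (green (\<lambda>_. \<phi>) \<omega> z \<nu> \<mu>)"
          by (intro mult_right_mono) auto
        then show ?case
          using assms(1) unfolding moment_def resolvent_entry_eq_green[OF elim z]
          by (intro ennreal_leI powr_mono2) auto
      qed
    qed
    also have "\<dots> \<le> ennreal (K * K * exp (- real n))"
      using \<phi> n(1) by (intro moment_decay[OF assms K r small z]) (auto simp: paired_def)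
    also have "\<dots> \<le> ennreal (K * K * exp 1 * exp (- (1 / 5) * site_dist \<mu> \<nu>))"
    proof (intro ennreal_leI)
      have "exp (- real n) \<le> exp (1 + - (1 / 5) * site_dist \<mu> \<nu>)" using sd by (simp only: exp_le_cancel_iff)
      then show "K * K * exp (- real n) \<le> K * K * exp 1 * exp (- (1 / 5) * site_dist \<mu> \<nu>)"
        unfolding exp_add mult.assoc[of "K * K"] by (intro mult_left_mono) auto
    qed
    finally show "(\<integral>\<^sup>+ \<omega>. ennreal (norm (resolvent_entry \<omega> \<phi> z \<mu> \<nu>) powr s) \<partial>Pomega)
        \<le> ennreal (K * K * exp 1 * exp (- (1 / 5) * site_dist \<mu> \<nu>))" .
  qed (use r K(1) in auto)
qed

end
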